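(* Let $\rho\in(1,2]$, $\mu,\lambda>0$ and $T>0$. Let $\{\alpha_k\}_{k\ge1}$ be i.i.d. random variables with the Gamma distribution $\Gamma(\mu,\lambda)$ on $(\bar\Omega,\bar{\mathcal F},\bar{\mathbb P})$, and let $W$ be a standard Brownian motion on $(\Omega,\mathcal F,\mathbb P)$. Let $Y_n(t)=\int_0^t \frac1n\sum_{k=1}^n s_{\alpha_k}(t-\tau)\,dW(\tau)$ and $Y(t)=\int_0^t G_\rho^\mu\left(-\frac{(t-\tau)^\rho}{\lambda}\right)dW(\tau)$. Then, $\bar{\mathbb P}$-almost surely (i.e. for $\bar{\mathbb P}$-a.e. realization of $(\alpha_k)_{k\ge1}$), the sequence $Y_n(t)$ converges to $Y(t)$ in $L^2(\Omega,\mathbb P)$ as $n\to\infty$, uniformly in $t\in[0,T]$.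
   Context: The space $(\bar\Omega,\bar{\mathcal F},\bar{\mathbb P})$ carrying the $\alpha_k$ is different from the space $(\Omega,\mathcal F,\mathbb P)$ carrying $W$, and the $\alpha_k$ are independent of $W$; the stochastic integrals are Wiener integrals under $\mathbb P$ with the realization of $(\alpha_k)$ fixed. The distribution $\Gamma(\mu,\lambda)$ has density $f(x)=\frac{1}{\Gamma(\mu)}\lambda e^{-\lambda x}(\lambda x)^{\mu-1}$ for $x>0$. With $g_\rho(t)=t^{\rho-1}/\Gamma(\rho)$, for $\alpha\ge0$ the scalar resolvent $s_\alpha:[0,\infty)\to\mathbb R$ is the solution of $s_\alpha(t)+\alpha\int_0^t g_\rho(t-\tau)s_\alpha(\tau)\,d\tau=1$, $t\ge0$; equivalently $s_\alpha(t)=E_\rho(-\alpha t^\rho)$ with $E_\rho(z)=\sum_{k\ge0}\frac{z^k}{\Gamma(\rho k+1)}$ the Mittag-Leffler function. $G_\rho^\mu(z)=\sum_{k=0}^\infty\frac{(\mu)_k}{\Gamma(k\rho+1)}z^k$, where $(\mu)_k=\Gamma(\mu+k)/\Gamma(\mu)$. *)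

theory Defs
  imports "HOL-Probability.Probability"
begin

definition square_integrable :: "'a measure \<Rightarrow> ('a \<Rightarrow> real) \<Rightarrow> bool" where
  "square_integrable M X \<longleftrightarrow> X \<in> borel_measurable M \<and> integrable M (\<lambda>\<omega>. (X \<omega>)\<^sup>2)"

definition L2_norm :: "'a measure \<Rightarrow> ('a \<Rightarrow> real) \<Rightarrow> real" where
  "L2_norm M X = sqrt (\<integral>\<omega>. (X \<omega>)\<^sup>2 \<partial>M)"

text \<open>Membership in \<open>L\<^sup>2\<close> is part of both notions of convergence below, since \<^const>\<open>L2_norm\<close>
  is meaningless (and equal to 0) on functions that are not square-integrable.\<close>

definition L2_tendsto :: "'a measure \<Rightarrow> (nat \<Rightarrow> 'a \<Rightarrow> real) \<Rightarrow> ('a \<Rightarrow> real) \<Rightarrow> bool" where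
  "L2_tendsto M Xs X \<longleftrightarrow>
     (\<forall>n. square_integrable M (Xs n)) \<and> square_integrable M X \<and>
     (\<lambda>n. L2_norm M (\<lambda>\<omega>. Xs n \<omega> - X \<omega>)) \<longlonglongrightarrow> 0"

definition L2_uniform_limit ::
  "'t set \<Rightarrow> 'a measure \<Rightarrow> (nat \<Rightarrow> 't \<Rightarrow> 'a \<Rightarrow> real) \<Rightarrow> ('t \<Rightarrow> 'a \<Rightarrow> real) \<Rightarrow> bool" where
  "L2_uniform_limit S M Xs X \<longleftrightarrow>
     (\<forall>n. \<forall>t\<in>S. square_integrable M (Xs n t)) \<and> (\<forall>t\<in>S. square_integrable M (X t)) \<and>
     uniform_limit S (\<lambda>n t. L2_norm M (\<lambda>\<omega>. Xs n t \<omega> - X t \<omega>)) (\<lambda>t. 0) sequentially"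

text \<open>The time parameter ranges over \<open>[0,\<infinity>)\<close>; the values of \<open>W\<close> at negative times are irrelevant.\<close>

definition standard_brownian_motion :: "'a measure \<Rightarrow> (real \<Rightarrow> 'a \<Rightarrow> real) \<Rightarrow> bool" where
  "standard_brownian_motion M W \<longleftrightarrow>
     prob_space M \<and>
     (\<forall>t\<ge>0. W t \<in> borel_measurable M) \<and>
     (AE \<omega> in M. W 0 \<omega> = 0) \<and>
     (\<forall>s t. 0 \<le> s \<and> s < t \<longrightarrow>
        distributed M lborel (\<lambda>\<omega>. W t \<omega> - W s \<omega>) (normal_density 0 (sqrt (t - s)))) \<and>
     (\<forall>n (p :: nat \<Rightarrow> real). 0 \<le> p 0 \<and> strict_mono_on {..n} p \<longrightarrow>
        prob_space.indep_vars M (\<lambda>_. borel) (\<lambda>i \<omega>. W (p (Suc i)) \<omega> - W (p i) \<omega>) {..<n}) \<and>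
     (AE \<omega> in M. continuous_on {0..} (\<lambda>t. W t \<omega>))"

definition step_function :: "nat \<Rightarrow> (nat \<Rightarrow> real) \<Rightarrow> (nat \<Rightarrow> real) \<Rightarrow> real \<Rightarrow> real" where
  "step_function m p c \<tau> = (\<Sum>i<m. c i * indicator {p i<..p (Suc i)} \<tau>)"

definition step_wiener_integral ::
  "(real \<Rightarrow> 'a \<Rightarrow> real) \<Rightarrow> nat \<Rightarrow> (nat \<Rightarrow> real) \<Rightarrow> (nat \<Rightarrow> real) \<Rightarrow> 'a \<Rightarrow> real" where
  "step_wiener_integral W m p c \<omega> = (\<Sum>i<m. c i * (W (p (Suc i)) \<omega> - W (p i) \<omega>))"

text \<open>\<open>X\<close> is (a version of) \<open>\<integral>\<^sub>0\<^sup>t f dW\<close> if it is the \<open>L\<^sup>2\<close>-limit of the integrals of step functions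
  approximating \<open>f\<close> in \<open>L\<^sup>2([0,t])\<close>. By the Ito isometry such an \<open>X\<close> is unique up to null sets.\<close>

definition has_wiener_integral ::
  "'a measure \<Rightarrow> (real \<Rightarrow> 'a \<Rightarrow> real) \<Rightarrow> real \<Rightarrow> (real \<Rightarrow> real) \<Rightarrow> ('a \<Rightarrow> real) \<Rightarrow> bool" where
  "has_wiener_integral M W t f X \<longleftrightarrow>
     (\<exists>m p c.
        (\<forall>j. 0 \<le> p j 0 \<and> mono_on {..m j} (p j) \<and> p j (m j) \<le> t) \<and>
        L2_tendsto (restrict_space lborel {0..t}) (\<lambda>j. step_function (m j) (p j) (c j)) f \<and>
        L2_tendsto M (\<lambda>j. step_wiener_integral W (m j) (p j) (c j)) X)"

definition wiener_integral ::
  "'a measure \<Rightarrow> (real \<Rightarrow> 'a \<Rightarrow> real) \<Rightarrow> real \<Rightarrow> (real \<Rightarrow> real) \<Rightarrow> 'a \<Rightarrow> real" where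
  "wiener_integral M W t f = (SOME X. has_wiener_integral M W t f X)"

definition gamma_density :: "real \<Rightarrow> real \<Rightarrow> real \<Rightarrow> real" where
  "gamma_density \<mu> lam x =
     (if x > 0 then 1 / Gamma \<mu> * lam * exp (- lam * x) * (lam * x) powr (\<mu> - 1) else 0)"

definition g_kernel :: "real \<Rightarrow> real \<Rightarrow> real" where
  "g_kernel \<rho> t = t powr (\<rho> - 1) / Gamma \<rho>"

text \<open>The solution is sought among continuous functions on \<open>[0,\<infinity>)\<close>; for \<open>\<rho> > 1\<close> the kernel is
  continuous, so this excludes no locally integrable solution. Extension by 0 to negative
  arguments only serves to make the solution unique as a function on all reals.\<close>

definition is_scalar_resolvent :: "real \<Rightarrow> real \<Rightarrow> (real \<Rightarrow> real) \<Rightarrow> bool" where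
  "is_scalar_resolvent \<rho> \<alpha> s \<longleftrightarrow>
     continuous_on {0..} s \<and> (\<forall>t<0. s t = 0) \<and>
     (\<forall>t\<ge>0. s t + \<alpha> * (LBINT \<tau>:{0..t}. g_kernel \<rho> (t - \<tau>) * s \<tau>) = 1)"

definition scalar_resolvent :: "real \<Rightarrow> real \<Rightarrow> real \<Rightarrow> real" where
  "scalar_resolvent \<rho> \<alpha> = (THE s. is_scalar_resolvent \<rho> \<alpha> s)"

definition G_function :: "real \<Rightarrow> real \<Rightarrow> real \<Rightarrow> real" where
  "G_function \<rho> \<mu> z = (\<Sum>k. pochhammer \<mu> k / Gamma (real k * \<rho> + 1) * z ^ k)"

end

theory Submission imports Defs
begin

text \<open>By the Ito isometry it suffices that the averages of \<open>s\<^bsub>\<alpha>\<^sub>k\<^esub>\<close> almost surely converge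
  to \<open>G\<close>, uniformly on \<open>[0,T]\<close>. Expanding \<open>s\<^sub>\<alpha>(u) = E\<^sub>\<rho>(-\<alpha>u\<^sup>\<rho>)\<close> into its power series,
  the average at \<open>u\<close> is a series in \<open>-u\<^sup>\<rho>\<close> with coefficients
  \<open>A\<^bsub>n,m\<^esub> / \<Gamma>(m\<rho> + 1)\<close>, where \<open>A\<^bsub>n,m\<^esub>\<close> is the empirical \<open>m\<close>-th moment, while \<open>G\<close> has the true
  moments \<open>(\<mu>)\<^sub>m / \<lambda>\<^sup>m\<close> instead. The strong law holds simultaneously for all
  powers \<open>\<alpha>\<^sup>m\<close> and for the dominating variable \<open>E\<^sub>\<rho>(\<alpha>T\<^sup>\<rho>)\<close>, which has finite fourth moment because
  \<open>\<rho> > 1\<close> makes \<open>E\<^sub>\<rho>\<close> grow slower than every exponential. Scheffe's lemma in the summation index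
  then bounds the difference uniformly in \<open>u\<close>.\<close>

subsection \<open>Square-integrable functions\<close>

text \<open>Two objects are given by choice operators and must be identified before anything can be
  estimated. \<open>wiener_integral\<close> is a \<open>SOME\<close>, so integrals are constructed
  for every continuous integrand, and uniqueness is replaced by an estimate valid for any two
  versions. \<open>scalar_resolvent\<close> is a \<open>THE\<close>, so the Mittag-Leffler series
  has to be both a solution of the Volterra equation and the only one. The obstacle to uniformity is
  that a strong law applied to s(u) gives one null set for each of uncountably many u. In the power
  series u enters only through the deterministic factor u^\<rho>, so countably many laws suffice,
  and in absolute value the worst case is u = T. Convergence of each coefficient alone would still
  let mass escape to large m. The strong law for the dominating variable excludes this: it says that
  the total of the nonnegative series at T converges to the right sum.\<close>

lemma square_integrable_mult:
  assumes "square_integrable M X" "square_integrable M Y"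
  shows "integrable M (\<lambda>\<omega>. X \<omega> * Y \<omega>)"
proof (rule Bochner_Integration.integrable_bound)
  show "integrable M (\<lambda>\<omega>. (X \<omega>)\<^sup>2 + (Y \<omega>)\<^sup>2)"
    using assms by (simp add: square_integrable_def)
  show "(\<lambda>\<omega>. X \<omega> * Y \<omega>) \<in> borel_measurable M"
    using assms by (auto simp: square_integrable_def)
  have "\<bar>x * y\<bar> \<le> x\<^sup>2 + y\<^sup>2" for x y :: real
  proof -
    have "2 * (\<bar>x\<bar> * \<bar>y\<bar>) \<le> x\<^sup>2 + y\<^sup>2" "0 \<le> \<bar>x\<bar> * \<bar>y\<bar>"
      using sum_squares_bound[of "\<bar>x\<bar>" "\<bar>y\<bar>"] by simp_all
    then show ?thesis unfolding abs_mult by linarith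
  qed
  then show "AE \<omega> in M. norm (X \<omega> * Y \<omega>) \<le> norm ((X \<omega>)\<^sup>2 + (Y \<omega>)\<^sup>2)"
    by auto
qed

lemma square_integrable_cmult:
  assumes "square_integrable M X"
  shows "square_integrable M (\<lambda>\<omega>. c * X \<omega>)"
  using assms by (auto simp: square_integrable_def power_mult_distrib)

lemma square_integrable_add:
  assumes "square_integrable M X" "square_integrable M Y"
  shows "square_integrable M (\<lambda>\<omega>. X \<omega> + Y \<omega>)"
proof -
  have "integrable M (\<lambda>\<omega>. (X \<omega>)\<^sup>2 + (Y \<omega>)\<^sup>2 + 2 * (X \<omega> * Y \<omega>))"
    using assms square_integrable_mult[OF assms] by (auto simp: square_integrable_def)
  then show ?thesis
    using assms by (auto simp: square_integrable_def power2_sum mult.assoc)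
qed

lemma square_integrable_diff:
  assumes "square_integrable M X" "square_integrable M Y"
  shows "square_integrable M (\<lambda>\<omega>. X \<omega> - Y \<omega>)"
  using square_integrable_add[OF assms(1) square_integrable_cmult[OF assms(2), of "-1"]] by simp

lemma square_integrable_sum:
  assumes "\<And>i. i \<in> I \<Longrightarrow> square_integrable M (X i)"
  shows "square_integrable M (\<lambda>\<omega>. \<Sum>i\<in>I. X i \<omega>)"
  using assms
proof (induction I rule: infinite_finite_induct)
  case (insert i I)
  then show ?case by (simp add: square_integrable_add)
qed (auto simp: square_integrable_def)

text \<open>Convexity of the square. It stands in for the triangle inequality, so that all estimates
  concern integrals of squares and not norms; two nested uses produce the later factor 9.\<close>

lemma L2_three_point:
  assumes "square_integrable M X" "square_integrable M X'"
    and "square_integrable M Y'" "square_integrable M Y"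
  shows "(\<integral>\<omega>. (X \<omega> - Y \<omega>)\<^sup>2 \<partial>M)
    \<le> 3 * ((\<integral>\<omega>. (X \<omega> - X' \<omega>)\<^sup>2 \<partial>M) + (\<integral>\<omega>. (X' \<omega> - Y' \<omega>)\<^sup>2 \<partial>M) + (\<integral>\<omega>. (Y' \<omega> - Y \<omega>)\<^sup>2 \<partial>M))"
proof -
  have sq: "integrable M (\<lambda>\<omega>. (X \<omega> - Y \<omega>)\<^sup>2)" "integrable M (\<lambda>\<omega>. (X \<omega> - X' \<omega>)\<^sup>2)"
    "integrable M (\<lambda>\<omega>. (X' \<omega> - Y' \<omega>)\<^sup>2)" "integrable M (\<lambda>\<omega>. (Y' \<omega> - Y \<omega>)\<^sup>2)"
    using square_integrable_diff[OF assms(1,4)] square_integrable_diff[OF assms(1,2)]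
      square_integrable_diff[OF assms(2,3)] square_integrable_diff[OF assms(3,4)]
    by (simp_all add: square_integrable_def)
  have *: "(x - y)\<^sup>2 \<le> 3 * ((x - x')\<^sup>2 + (x' - y')\<^sup>2 + (y' - y)\<^sup>2)" for x x' y y' :: real
  proof -
    define a b c where "a = x - x'" and "b = x' - y'" and "c = y' - y"
    have "(a + b + c)\<^sup>2 \<le> 3 * (a\<^sup>2 + b\<^sup>2 + c\<^sup>2)"
      using zero_le_power2[of "a - b"] zero_le_power2[of "b - c"] zero_le_power2[of "a - c"]
      by (simp add: power2_eq_square algebra_simps)
    then show ?thesis by (simp add: a_def b_def c_def)
  qed
  have "(\<integral>\<omega>. (X \<omega> - Y \<omega>)\<^sup>2 \<partial>M)
      \<le> (\<integral>\<omega>. 3 * ((X \<omega> - X' \<omega>)\<^sup>2 + (X' \<omega> - Y' \<omega>)\<^sup>2 + (Y' \<omega> - Y \<omega>)\<^sup>2) \<partial>M)"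
    by (intro integral_mono integrable_mult_right Bochner_Integration.integrable_add sq *)
  also have "\<dots> = 3 * ((\<integral>\<omega>. (X \<omega> - X' \<omega>)\<^sup>2 \<partial>M) + (\<integral>\<omega>. (X' \<omega> - Y' \<omega>)\<^sup>2 \<partial>M)
      + (\<integral>\<omega>. (Y' \<omega> - Y \<omega>)\<^sup>2 \<partial>M))"
    by (simp only: integral_mult_right_zero Bochner_Integration.integral_add
        Bochner_Integration.integrable_add sq)
  finally show ?thesis .
qed

lemma L2_norm_power2: "(L2_norm M X)\<^sup>2 = (\<integral>\<omega>. (X \<omega>)\<^sup>2 \<partial>M)"
  unfolding L2_norm_def by (rule real_sqrt_pow2, rule integral_nonneg_AE, rule AE_I2, rule zero_le_power2)

lemma L2_tendsto_square:
  assumes "L2_tendsto M Xs X"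
  shows "(\<lambda>n. \<integral>\<omega>. (Xs n \<omega> - X \<omega>)\<^sup>2 \<partial>M) \<longlonglongrightarrow> 0"
proof -
  have "(\<lambda>n. L2_norm M (\<lambda>\<omega>. Xs n \<omega> - X \<omega>)) \<longlonglongrightarrow> 0"
    using assms unfolding L2_tendsto_def by blast
  from tendsto_power[OF this, of 2] show ?thesis
    unfolding L2_norm_power2 zero_power2 .
qed

lemma L2_tendstoI:
  assumes "\<And>n. square_integrable M (Xs n)" "square_integrable M X"
    and "\<And>n. (\<integral>\<omega>. (Xs n \<omega> - X \<omega>)\<^sup>2 \<partial>M) \<le> e n" and "e \<longlonglongrightarrow> 0"
  shows "L2_tendsto M Xs X"
proof -
  have "(\<lambda>n. \<integral>\<omega>. (Xs n \<omega> - X \<omega>)\<^sup>2 \<partial>M) \<longlonglongrightarrow> 0"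
    by (rule tendsto_sandwich[OF _ _ tendsto_const assms(4)])
      (intro always_eventually allI integral_nonneg_AE AE_I2 zero_le_power2 assms(3))+
  then have "(\<lambda>n. sqrt (\<integral>\<omega>. (Xs n \<omega> - X \<omega>)\<^sup>2 \<partial>M)) \<longlonglongrightarrow> sqrt 0"
    by (rule tendsto_real_sqrt)
  then show ?thesis
    using assms(1,2) by (simp add: L2_tendsto_def L2_norm_def)
qed

section \<open>Completeness of L2 along geometrically Cauchy sequences\<close>

text \<open>Monotone convergence: the sum of the series has finite integral, hence is finite almost
  everywhere. It serves both the completeness of L2 and the strong law.\<close>

lemma AE_summable_of_summable_integral:
  fixes f :: "nat \<Rightarrow> 'a \<Rightarrow> real"
  assumes int: "\<And>i. integrable M (f i)" and nonneg: "\<And>i \<omega>. 0 \<le> f i \<omega>"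
    and sum: "summable (\<lambda>i. \<integral>\<omega>. f i \<omega> \<partial>M)"
  shows "AE \<omega> in M. summable (\<lambda>i. f i \<omega>)"
proof -
  have [measurable]: "f i \<in> borel_measurable M" for i
    using int by auto
  have "(\<integral>\<^sup>+\<omega>. (\<Sum>i. ennreal (f i \<omega>)) \<partial>M) = (\<Sum>i. \<integral>\<^sup>+\<omega>. ennreal (f i \<omega>) \<partial>M)"
    by (intro nn_integral_suminf) auto
  also have "\<dots> = (\<Sum>i. ennreal (\<integral>\<omega>. f i \<omega> \<partial>M))"
    using int nonneg by (simp add: nn_integral_eq_integral)
  also have "\<dots> = ennreal (\<Sum>i. \<integral>\<omega>. f i \<omega> \<partial>M)"
    by (intro suminf_ennreal2 sum integral_nonneg_AE AE_I2 nonneg)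
  finally have "(\<integral>\<^sup>+\<omega>. (\<Sum>i. ennreal (f i \<omega>)) \<partial>M) \<noteq> \<infinity>" by simp
  then have "AE \<omega> in M. (\<Sum>i. ennreal (f i \<omega>)) \<noteq> \<infinity>"
    by (intro nn_integral_PInf_AE) auto
  then show ?thesis
    by eventually_elim (use nonneg in \<open>auto intro: summable_suminf_not_top\<close>)
qed

text \<open>Riesz-Fischer for a geometric rate, at which the whole sequence and not only a
  subsequence converges almost everywhere.\<close>

lemma L2_fast_Cauchy_convergent:
  fixes X :: "nat \<Rightarrow> 'a \<Rightarrow> real"
  assumes sq: "\<And>n. square_integrable M (X n)"
    and cauchy: "\<And>i j. i \<le> j \<Longrightarrow> (\<integral>\<omega>. (X j \<omega> - X i \<omega>)\<^sup>2 \<partial>M) \<le> C * (1/4) ^ i"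
  shows "\<exists>Y. L2_tendsto M X Y"
proof -
  have [measurable]: "X n \<in> borel_measurable M" for n
    using sq by (auto simp: square_integrable_def)
  have intd: "integrable M (\<lambda>\<omega>. (X j \<omega> - X i \<omega>)\<^sup>2)" for i j
    using square_integrable_diff[OF sq sq] by (auto simp: square_integrable_def)
  \<comment> \<open>Against the rate 4^-i the weight 2^i still leaves the summable 2^-i; it is what
    allows passing from squared increments to the increments themselves.\<close>
  have "AE \<omega> in M. summable (\<lambda>i. 2 ^ i * (X (Suc i) \<omega> - X i \<omega>)\<^sup>2)"
  proof (rule AE_summable_of_summable_integral)
    show "summable (\<lambda>i. \<integral>\<omega>. 2 ^ i * (X (Suc i) \<omega> - X i \<omega>)\<^sup>2 \<partial>M)"
    proof (rule summable_comparison_test')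
      show "summable (\<lambda>i. C * (1/2) ^ i)"
        by (intro summable_mult summable_geometric) auto
      fix i :: nat
      have "(\<integral>\<omega>. 2 ^ i * (X (Suc i) \<omega> - X i \<omega>)\<^sup>2 \<partial>M) \<le> 2 ^ i * (C * (1/4) ^ i)"
        using cauchy[of i "Suc i"] by simp
      also have "\<dots> = C * (2 * (1/4)) ^ i"
        unfolding power_mult_distrib by simp
      finally show "norm (\<integral>\<omega>. 2 ^ i * (X (Suc i) \<omega> - X i \<omega>)\<^sup>2 \<partial>M) \<le> C * (1/2) ^ i"
        by simp
    qed
  qed (use intd in auto)
  then have conv: "AE \<omega> in M. convergent (\<lambda>n. X n \<omega>)"
  proof eventually_elim
    case (elim \<omega>)
    have "summable (\<lambda>i. X (Suc i) \<omega> - X i \<omega>)"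
    proof (rule summable_comparison_test')
      show "summable (\<lambda>i. 2 ^ i * (X (Suc i) \<omega> - X i \<omega>)\<^sup>2 + (1/2) ^ i)"
        using elim by (intro summable_add summable_geometric) auto
      fix i :: nat
      define d where "d = \<bar>X (Suc i) \<omega> - X i \<omega>\<bar>"
      \<comment> \<open>Expanding this square gives 2 d \<le> 2^i d^2 + 2^-i.\<close>
      have "0 \<le> (d * 2 ^ i - 1)\<^sup>2" by simp
      then have "2 * d * 2 ^ i \<le> (d * 2 ^ i)\<^sup>2 + 1" by (simp add: power2_diff)
      then have "2 * d \<le> ((d * 2 ^ i)\<^sup>2 + 1) / 2 ^ i" by (simp add: field_simps)
      also have "\<dots> = 2 ^ i * d\<^sup>2 + (1/2) ^ i"
        by (simp add: field_simps power2_eq_square)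
      finally have "2 * d \<le> 2 ^ i * d\<^sup>2 + (1/2) ^ i" .
      moreover have "0 \<le> d" by (simp add: d_def)
      ultimately have "d \<le> 2 ^ i * d\<^sup>2 + (1/2) ^ i" by linarith
      then show "norm (X (Suc i) \<omega> - X i \<omega>) \<le> 2 ^ i * (X (Suc i) \<omega> - X i \<omega>)\<^sup>2 + (1/2) ^ i"
        by (simp add: d_def)
    qed
    then have "convergent (\<lambda>n. \<Sum>i<n. X (Suc i) \<omega> - X i \<omega>)"
      by (simp add: summable_iff_convergent)
    then have "convergent (\<lambda>n. X n \<omega> - X 0 \<omega>)"
      by (simp only: sum_lessThan_telescope[of "\<lambda>i. X i \<omega>"])
    then show ?case
      using convergent_add[OF _ convergent_const[of "X 0 \<omega>"]] by fastforce
  qed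
  define Y where "Y = (\<lambda>\<omega>. lim (\<lambda>n. X n \<omega>))"
  have [measurable]: "Y \<in> borel_measurable M"
    unfolding Y_def by (intro borel_measurable_lim_metric) auto
  have lim: "AE \<omega> in M. (\<lambda>n. X n \<omega>) \<longlonglongrightarrow> Y \<omega>"
    using conv by eventually_elim (auto simp: Y_def convergent_LIMSEQ_iff)
  \<comment> \<open>The case i = j = 0. The sign is needed to read the \<open>ennreal\<close> bound
    back as a real one, since \<open>ennreal\<close> is 0 on negative numbers.\<close>
  have C: "0 \<le> C"
    using order_trans[OF integral_nonneg_AE cauchy[of 0 0]] by simp
  \<comment> \<open>Fatou's lemma: almost everywhere (X i - Y)^2 is the limit in j of (X j - X i)^2,
    whose integrals share one bound for all j \<ge> i.\<close>
  have bound: "(\<integral>\<^sup>+\<omega>. ennreal ((X i \<omega> - Y \<omega>)\<^sup>2) \<partial>M) \<le> ennreal (C * (1/4) ^ i)" for i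
  proof -
    have "(\<integral>\<^sup>+\<omega>. ennreal ((X i \<omega> - Y \<omega>)\<^sup>2) \<partial>M)
        = (\<integral>\<^sup>+\<omega>. liminf (\<lambda>j. ennreal ((X j \<omega> - X i \<omega>)\<^sup>2)) \<partial>M)"
    proof (rule nn_integral_cong_AE, use lim in eventually_elim)
      case (elim \<omega>)
      have "(\<lambda>j. ennreal ((X j \<omega> - X i \<omega>)\<^sup>2)) \<longlonglongrightarrow> ennreal ((Y \<omega> - X i \<omega>)\<^sup>2)"
        using elim by (intro tendsto_intros) auto
      then show ?case
        by (subst lim_imp_Liminf) (simp_all add: power2_commute)
    qed
    also have "\<dots> \<le> liminf (\<lambda>j. \<integral>\<^sup>+\<omega>. ennreal ((X j \<omega> - X i \<omega>)\<^sup>2) \<partial>M)"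
      by (intro nn_integral_liminf) auto
    also have "\<dots> = liminf (\<lambda>j. ennreal (\<integral>\<omega>. (X j \<omega> - X i \<omega>)\<^sup>2 \<partial>M))"
      using intd by (simp add: nn_integral_eq_integral)
    also have "\<dots> \<le> liminf (\<lambda>j. ennreal (C * (1/4) ^ i))"
    proof (rule Liminf_mono)
      show "\<forall>\<^sub>F j in sequentially. ennreal (\<integral>\<omega>. (X j \<omega> - X i \<omega>)\<^sup>2 \<partial>M) \<le> ennreal (C * (1/4) ^ i)"
        using eventually_ge_at_top[of i] by eventually_elim (intro ennreal_leI cauchy)
    qed
    finally show ?thesis by (simp add: Liminf_const)
  qed
  have int: "integrable M (\<lambda>\<omega>. (X i \<omega> - Y \<omega>)\<^sup>2)" for i
  proof (rule integrableI_nonneg)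
    show "(\<integral>\<^sup>+\<omega>. ennreal ((X i \<omega> - Y \<omega>)\<^sup>2) \<partial>M) < \<infinity>"
      using le_less_trans[OF bound[of i]] by simp
  qed simp_all
  have "square_integrable M (\<lambda>\<omega>. X 0 \<omega> - Y \<omega>)"
    unfolding square_integrable_def using int by simp
  then have "square_integrable M (\<lambda>\<omega>. X 0 \<omega> - (X 0 \<omega> - Y \<omega>))"
    by (rule square_integrable_diff[OF sq])
  then have "square_integrable M Y" by simp
  moreover have "(\<integral>\<omega>. (X i \<omega> - Y \<omega>)\<^sup>2 \<partial>M) \<le> C * (1/4) ^ i" for i
    using bound[of i] int[of i] C by (simp add: nn_integral_eq_integral)
  moreover have "(\<lambda>i. C * (1/4) ^ i) \<longlonglongrightarrow> 0"
    by (intro tendsto_mult_right_zero LIMSEQ_realpow_zero) auto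
  ultimately have "L2_tendsto M X Y"
    by (rule L2_tendstoI[OF sq])
  then show "\<exists>Y. L2_tendsto M X Y"
    by (rule exI[where x = Y])
qed

subsection \<open>The Wiener integral\<close>

lemma brownian_increment:
  assumes W: "standard_brownian_motion M W" and st: "0 \<le> s" "s \<le> t"
  shows "square_integrable M (\<lambda>\<omega>. W t \<omega> - W s \<omega>)"
    and "(\<integral>\<omega>. (W t \<omega> - W s \<omega>)\<^sup>2 \<partial>M) = t - s"
proof -
  have meas: "(\<lambda>\<omega>. W t \<omega> - W s \<omega>) \<in> borel_measurable M"
    using W st unfolding standard_brownian_motion_def by (intro borel_measurable_diff) auto
  have "square_integrable M (\<lambda>\<omega>. W t \<omega> - W s \<omega>) \<and> (\<integral>\<omega>. (W t \<omega> - W s \<omega>)\<^sup>2 \<partial>M) = t - s"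
  \<comment> \<open>Brownian motion has a prescribed law of increments only for s < t; at s = t the
    increment is identically 0.\<close>
  proof (cases "s = t")
    case False
    then have D: "distributed M lborel (\<lambda>\<omega>. W t \<omega> - W s \<omega>) (normal_density 0 (sqrt (t - s)))"
      and pos: "0 < sqrt (t - s)"
      using W st unfolding standard_brownian_motion_def by auto
    have "integrable M (\<lambda>\<omega>. (W t \<omega> - W s \<omega>)\<^sup>2)"
      using distributed_integrable[OF D, of "\<lambda>x. x\<^sup>2"] integrable_normal_moment[OF pos, of 0 2]
      by simp
    moreover have "(\<integral>\<omega>. (W t \<omega> - W s \<omega>)\<^sup>2 \<partial>M) = t - s"
      using distributed_integral[OF D, of "\<lambda>x. x\<^sup>2"] integral_normal_moment_even[OF pos, of 0 1] st
      by simp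
    ultimately show ?thesis
      using meas by (simp add: square_integrable_def)
  qed (simp add: square_integrable_def)
  then show "square_integrable M (\<lambda>\<omega>. W t \<omega> - W s \<omega>)"
    and "(\<integral>\<omega>. (W t \<omega> - W s \<omega>)\<^sup>2 \<partial>M) = t - s" by auto
qed

text \<open>By polarisation only the variance of the increments enters, not their independence.\<close>

lemma brownian_increment_product:
  assumes W: "standard_brownian_motion M W" and "0 \<le> a" "a \<le> b" "0 \<le> c" "c \<le> d"
  shows "(\<integral>\<omega>. (W b \<omega> - W a \<omega>) * (W d \<omega> - W c \<omega>) \<partial>M)
    = (\<integral>x. indicator {a<..b} x * indicator {c<..d} x \<partial>lborel)"
proof -
  define Q where "Q u v = (\<lambda>\<omega>. (W u \<omega> - W v \<omega>)\<^sup>2)" for u v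
  \<comment> \<open>Stated for either order of the times, because the two intervals may lie in any
    relative position.\<close>
  have Q: "integrable M (Q u v) \<and> integral\<^sup>L M (Q u v) = \<bar>u - v\<bar>" if "0 \<le> u" "0 \<le> v" for u v
  proof (cases "v \<le> u")
    case True
    then show ?thesis
      using brownian_increment[OF W \<open>0 \<le> v\<close> True] by (simp add: Q_def square_integrable_def)
  next
    case False
    moreover have "Q u v = Q v u"
      by (auto simp: Q_def power2_commute)
    ultimately show ?thesis
      using brownian_increment[OF W \<open>0 \<le> u\<close>, of v] by (simp add: Q_def square_integrable_def)
  qed
  have "(W b \<omega> - W a \<omega>) * (W d \<omega> - W c \<omega>)
      = (Q d a \<omega> + Q c b \<omega> - Q d b \<omega> - Q c a \<omega>) / 2" for \<omega>
    by (simp add: Q_def power2_eq_square algebra_simps)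
  then have "(\<integral>\<omega>. (W b \<omega> - W a \<omega>) * (W d \<omega> - W c \<omega>) \<partial>M)
      = (\<integral>\<omega>. (Q d a \<omega> + Q c b \<omega> - Q d b \<omega> - Q c a \<omega>) / 2 \<partial>M)"
    by (intro Bochner_Integration.integral_cong) auto
  also have "\<dots> = (\<bar>d - a\<bar> + \<bar>c - b\<bar> - \<bar>d - b\<bar> - \<bar>c - a\<bar>) / 2"
    using Q assms by simp
  \<comment> \<open>The combination of absolute values is the length of the overlap; for disjoint
    intervals it cancels to 0, the measure of an empty interval.\<close>
  also have "\<dots> = measure lborel {max a c<..min b d}"
    using assms by (cases "max a c \<le> min b d") (auto simp: max_def min_def split: if_splits)
  also have "\<dots> = (\<integral>x. indicator {max a c<..min b d} x \<partial>lborel)"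
    by simp
  also have "\<dots> = (\<integral>x. indicator {a<..b} x * indicator {c<..d} x \<partial>lborel)"
    by (intro Bochner_Integration.integral_cong) (auto simp: indicator_def)
  finally show ?thesis .
qed

section \<open>Isometry for step functions\<close>

definition valid_partition :: "real \<Rightarrow> nat \<Rightarrow> (nat \<Rightarrow> real) \<Rightarrow> bool" where
  "valid_partition t m p \<longleftrightarrow> 0 \<le> p 0 \<and> mono_on {..m} p \<and> p m \<le> t"

lemma valid_partitionD:
  assumes "valid_partition t m p" "i < m"
  shows "0 \<le> p i" "p i \<le> p (Suc i)" "p (Suc i) \<le> t"
proof -
  have "p 0 \<le> p i" "p i \<le> p (Suc i)" "p (Suc i) \<le> p m"
    using assms by (auto simp: valid_partition_def intro: mono_onD)
  then show "0 \<le> p i" "p i \<le> p (Suc i)" "p (Suc i) \<le> t"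
    using assms by (auto simp: valid_partition_def)
qed

lemma square_integrable_step_wiener:
  assumes "standard_brownian_motion M W" "valid_partition t m p"
  shows "square_integrable M (step_wiener_integral W m p c)"
  unfolding step_wiener_integral_def using valid_partitionD[OF assms(2)]
  by (intro square_integrable_sum square_integrable_cmult brownian_increment[OF assms(1)]) auto

lemma integrable_indicator_Ioc [simp]:
  "integrable lborel (indicator {a<..b} :: real \<Rightarrow> real)"
  by (cases "a \<le> b") auto

lemma square_integrable_step_function:
  "square_integrable lborel (step_function m p c)"
  unfolding step_function_def
  by (intro square_integrable_sum square_integrable_cmult)
     (simp_all add: square_integrable_def power2_eq_square flip: indicator_inter_arith)

lemma integral_double_sum:
  fixes f :: "nat \<Rightarrow> nat \<Rightarrow> 'a \<Rightarrow> real"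
  assumes int: "\<And>i j. i < m \<Longrightarrow> j < n \<Longrightarrow> integrable M (f i j)"
  shows "(\<integral>\<omega>. (\<Sum>i<m. \<Sum>j<n. a i * b j * f i j \<omega>) \<partial>M) = (\<Sum>i<m. \<Sum>j<n. a i * b j * (\<integral>\<omega>. f i j \<omega> \<partial>M))"
proof -
  have int': "integrable M (\<lambda>\<omega>. a i * b j * f i j \<omega>)" if "i < m" "j < n" for i j
    using int[OF that] by simp
  have "(\<integral>\<omega>. (\<Sum>i<m. \<Sum>j<n. a i * b j * f i j \<omega>) \<partial>M) = (\<Sum>i<m. \<integral>\<omega>. (\<Sum>j<n. a i * b j * f i j \<omega>) \<partial>M)"
    using int' by (intro Bochner_Integration.integral_sum Bochner_Integration.integrable_sum) auto
  also have "\<dots> = (\<Sum>i<m. \<Sum>j<n. \<integral>\<omega>. a i * b j * f i j \<omega> \<partial>M)"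
    using int' by (intro sum.cong refl Bochner_Integration.integral_sum) auto
  finally show ?thesis by simp
qed

text \<open>Bilinearity reduces both sides to pairs of cells. Since
  \<open>brownian_increment_product\<close> covers overlapping cells, the two partitions are
  compared without a common refinement.\<close>

lemma step_wiener_inner:
  assumes W: "standard_brownian_motion M W"
    and p: "valid_partition t m p" and q: "valid_partition t n q"
  shows "(\<integral>\<omega>. step_wiener_integral W m p c \<omega> * step_wiener_integral W n q d \<omega> \<partial>M)
    = (\<integral>x. step_function m p c x * step_function n q d x \<partial>lborel)"
proof -
  note P = valid_partitionD[OF p] and Q = valid_partitionD[OF q]
  have int: "integrable M (\<lambda>\<omega>. (W (p (Suc i)) \<omega> - W (p i) \<omega>) * (W (q (Suc j)) \<omega> - W (q j) \<omega>))"
    if "i < m" "j < n" for i j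
    using that P Q by (intro square_integrable_mult brownian_increment[OF W]) auto
  have int': "integrable lborel (\<lambda>x. indicator {p i<..p (Suc i)} x * indicator {q j<..q (Suc j)} x :: real)" for i j
    by (simp flip: indicator_inter_arith)
  have "(\<integral>\<omega>. step_wiener_integral W m p c \<omega> * step_wiener_integral W n q d \<omega> \<partial>M)
      = (\<integral>\<omega>. (\<Sum>i<m. \<Sum>j<n. c i * d j * ((W (p (Suc i)) \<omega> - W (p i) \<omega>) * (W (q (Suc j)) \<omega> - W (q j) \<omega>))) \<partial>M)"
    by (simp add: step_wiener_integral_def sum_product mult_ac)
  also have "\<dots> = (\<Sum>i<m. \<Sum>j<n. c i * d j * (\<integral>\<omega>. (W (p (Suc i)) \<omega> - W (p i) \<omega>) * (W (q (Suc j)) \<omega> - W (q j) \<omega>) \<partial>M))"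
    using int by (intro integral_double_sum) auto
  also have "\<dots> = (\<Sum>i<m. \<Sum>j<n. c i * d j * (\<integral>x. indicator {p i<..p (Suc i)} x * indicator {q j<..q (Suc j)} x \<partial>lborel))"
    using P Q by (intro sum.cong refl arg_cong2[where f = "(*)"] brownian_increment_product[OF W]) auto
  also have "\<dots> = (\<integral>x. (\<Sum>i<m. \<Sum>j<n. c i * d j * (indicator {p i<..p (Suc i)} x * indicator {q j<..q (Suc j)} x)) \<partial>lborel)"
    using int' by (intro integral_double_sum[symmetric])
  also have "\<dots> = (\<integral>x. step_function m p c x * step_function n q d x \<partial>lborel)"
    unfolding step_function_def sum_product
    by (intro Bochner_Integration.integral_cong refl sum.cong) (simp add: mult_ac)
  finally show ?thesis .
qed

lemma step_wiener_isometry: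
  assumes W: "standard_brownian_motion M W"
    and p: "valid_partition t m p" and q: "valid_partition t n q"
  shows "(\<integral>\<omega>. (step_wiener_integral W m p c \<omega> - step_wiener_integral W n q d \<omega>)\<^sup>2 \<partial>M)
    = (\<integral>x. (step_function m p c x - step_function n q d x)\<^sup>2 \<partial>restrict_space lborel {0..t})"
proof -
  \<comment> \<open>Generic in the measure, because it is applied under \<open>M\<close> and under
    Lebesgue measure alike.\<close>
  have expand: "(\<integral>\<omega>. (X \<omega> - Y \<omega>)\<^sup>2 \<partial>L)
      = (\<integral>\<omega>. X \<omega> * X \<omega> \<partial>L) - 2 * (\<integral>\<omega>. X \<omega> * Y \<omega> \<partial>L) + (\<integral>\<omega>. Y \<omega> * Y \<omega> \<partial>L)"
    if "square_integrable L X" "square_integrable L Y" for L :: "'c measure" and X Y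
  proof -
    have "(X \<omega> - Y \<omega>)\<^sup>2 = X \<omega> * X \<omega> - 2 * (X \<omega> * Y \<omega>) + Y \<omega> * Y \<omega>" for \<omega>
      by (simp add: power2_eq_square algebra_simps)
    then show ?thesis
      using square_integrable_mult[OF that(1,1)] square_integrable_mult[OF that(1,2)]
        square_integrable_mult[OF that(2,2)]
      by simp
  qed
  \<comment> \<open>All cells lie in [0, t], so integrating over the line and over [0, t] gives the
    same value.\<close>
  have supp: "step_function m p c x = 0" if "valid_partition t m p" "x \<notin> {0..t}" for m p c x
    unfolding step_function_def
  proof (rule sum.neutral, rule ballI)
    fix i assume "i \<in> {..<m}"
    then have "x \<notin> {p i<..p (Suc i)}"
      using valid_partitionD[OF that(1), of i] that(2) by auto
    then show "c i * indicator {p i<..p (Suc i)} x = 0" by simp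
  qed
  have "(\<integral>\<omega>. (step_wiener_integral W m p c \<omega> - step_wiener_integral W n q d \<omega>)\<^sup>2 \<partial>M)
      = (\<integral>x. (step_function m p c x - step_function n q d x)\<^sup>2 \<partial>lborel)"
    using assms
    by (simp add: expand square_integrable_step_wiener square_integrable_step_function step_wiener_inner)
  also have "\<dots> = (\<integral>x. indicator {0..t} x *\<^sub>R (step_function m p c x - step_function n q d x)\<^sup>2 \<partial>lborel)"
    using supp[OF p] supp[OF q] by (intro Bochner_Integration.integral_cong refl) (simp split: split_indicator)
  also have "\<dots> = (\<integral>x. (step_function m p c x - step_function n q d x)\<^sup>2 \<partial>restrict_space lborel {0..t})"
    by (subst integral_restrict_space) auto
  finally show ?thesis .
qed

text \<open>The isometry up to the factor 9, the price for not using Minkowski's inequality.\<close>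

lemma has_wiener_integral_contraction:
  assumes W: "standard_brownian_motion M W"
    and X: "has_wiener_integral M W t f X" and Y: "has_wiener_integral M W t g Y"
  shows "(\<integral>\<omega>. (X \<omega> - Y \<omega>)\<^sup>2 \<partial>M) \<le> 9 * (\<integral>x. (f x - g x)\<^sup>2 \<partial>restrict_space lborel {0..t})"
proof -
  let ?L = "restrict_space lborel {0..t}"
  obtain m p c where p: "\<And>j. valid_partition t (m j) (p j)"
    and f: "L2_tendsto ?L (\<lambda>j. step_function (m j) (p j) (c j)) f"
    and X: "L2_tendsto M (\<lambda>j. step_wiener_integral W (m j) (p j) (c j)) X"
    using X unfolding has_wiener_integral_def valid_partition_def by blast
  obtain n q d where q: "\<And>j. valid_partition t (n j) (q j)"
    and g: "L2_tendsto ?L (\<lambda>j. step_function (n j) (q j) (d j)) g"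
    and Y: "L2_tendsto M (\<lambda>j. step_wiener_integral W (n j) (q j) (d j)) Y"
    using Y unfolding has_wiener_integral_def valid_partition_def by blast
  define x where "x j = step_wiener_integral W (m j) (p j) (c j)" for j
  define y where "y j = step_wiener_integral W (n j) (q j) (d j)" for j
  define u where "u j = step_function (m j) (p j) (c j)" for j
  define v where "v j = step_function (n j) (q j) (d j)" for j
  note lims = f[folded u_def] X[folded x_def] g[folded v_def] Y[folded y_def]
  have sq: "square_integrable ?L (u j)" "square_integrable ?L f" "square_integrable ?L (v j)"
    "square_integrable ?L g" "square_integrable M (x j)" "square_integrable M X"
    "square_integrable M (y j)" "square_integrable M Y" for j
    using lims by (simp_all add: L2_tendsto_def)
  \<comment> \<open>X and Y are joined through the approximants \<open>x j\<close> and
    \<open>y j\<close>. The isometry turns the middle gap into one on [0, t], where f and g are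
    inserted; every other term vanishes as j grows.\<close>
  have "(\<integral>\<omega>. (X \<omega> - Y \<omega>)\<^sup>2 \<partial>M) \<le> 3 * ((\<integral>\<omega>. (x j \<omega> - X \<omega>)\<^sup>2 \<partial>M)
      + 3 * ((\<integral>\<omega>. (u j \<omega> - f \<omega>)\<^sup>2 \<partial>?L) + (\<integral>\<omega>. (f \<omega> - g \<omega>)\<^sup>2 \<partial>?L) + (\<integral>\<omega>. (v j \<omega> - g \<omega>)\<^sup>2 \<partial>?L))
      + (\<integral>\<omega>. (y j \<omega> - Y \<omega>)\<^sup>2 \<partial>M))" for j
  proof -
    have "(\<integral>\<omega>. (x j \<omega> - y j \<omega>)\<^sup>2 \<partial>M) = (\<integral>\<omega>. (u j \<omega> - v j \<omega>)\<^sup>2 \<partial>?L)"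
      unfolding x_def y_def u_def v_def by (rule step_wiener_isometry[OF W p q])
    also have "\<dots> \<le> 3 * ((\<integral>\<omega>. (u j \<omega> - f \<omega>)\<^sup>2 \<partial>?L) + (\<integral>\<omega>. (f \<omega> - g \<omega>)\<^sup>2 \<partial>?L)
        + (\<integral>\<omega>. (g \<omega> - v j \<omega>)\<^sup>2 \<partial>?L))"
      by (intro L2_three_point sq)
    finally have "(\<integral>\<omega>. (x j \<omega> - y j \<omega>)\<^sup>2 \<partial>M) \<le> \<dots>" .
    moreover have "(\<integral>\<omega>. (X \<omega> - Y \<omega>)\<^sup>2 \<partial>M) \<le> 3 * ((\<integral>\<omega>. (X \<omega> - x j \<omega>)\<^sup>2 \<partial>M)
        + (\<integral>\<omega>. (x j \<omega> - y j \<omega>)\<^sup>2 \<partial>M) + (\<integral>\<omega>. (y j \<omega> - Y \<omega>)\<^sup>2 \<partial>M))"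
      by (intro L2_three_point sq)
    ultimately show ?thesis
      by (simp add: power2_commute[of "X _"] power2_commute[of "g _" "v j _"])
  qed
  moreover have "(\<lambda>j. 3 * ((\<integral>\<omega>. (x j \<omega> - X \<omega>)\<^sup>2 \<partial>M)
      + 3 * ((\<integral>\<omega>. (u j \<omega> - f \<omega>)\<^sup>2 \<partial>?L) + (\<integral>\<omega>. (f \<omega> - g \<omega>)\<^sup>2 \<partial>?L) + (\<integral>\<omega>. (v j \<omega> - g \<omega>)\<^sup>2 \<partial>?L))
      + (\<integral>\<omega>. (y j \<omega> - Y \<omega>)\<^sup>2 \<partial>M)))
    \<longlonglongrightarrow> 3 * (0 + 3 * (0 + (\<integral>\<omega>. (f \<omega> - g \<omega>)\<^sup>2 \<partial>?L) + 0) + 0)"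
    by (intro tendsto_intros lims[THEN L2_tendsto_square])
  ultimately have "(\<integral>\<omega>. (X \<omega> - Y \<omega>)\<^sup>2 \<partial>M) \<le> 3 * (0 + 3 * (0 + (\<integral>\<omega>. (f \<omega> - g \<omega>)\<^sup>2 \<partial>?L) + 0) + 0)"
    by (intro LIMSEQ_le_const) auto
  then show ?thesis by simp
qed

section \<open>Existence of the Wiener integral of a continuous function\<close>

text \<open>Uniform continuity on an equidistant mesh. Cells are open on the left, so none contains
  0; the approximation is claimed for 0 < x only, which loses a null set.\<close>

lemma step_function_approx:
  fixes f :: "real \<Rightarrow> real"
  assumes t: "0 \<le> t" and f: "continuous_on {0..t} f" and e: "0 < e"
  obtains m p c where "valid_partition t m p"
    and "\<And>x. 0 < x \<Longrightarrow> x \<le> t \<Longrightarrow> \<bar>step_function m p c x - f x\<bar> \<le> e"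
proof -
  have "uniformly_continuous_on {0..t} f"
    using f by (intro compact_uniformly_continuous) auto
  then obtain r where r: "0 < r"
    and unif: "\<And>x y. x \<in> {0..t} \<Longrightarrow> y \<in> {0..t} \<Longrightarrow> dist y x < r \<Longrightarrow> dist (f y) (f x) < e"
    using e unfolding uniformly_continuous_on_def by metis
  obtain n :: nat where n: "t / r < real n" using reals_Archimedean2 by blast
  define m where "m = Suc n"
  define p where "p i = real i * (t / m)" for i
  have tm: "0 \<le> t / m" "t / m < r"
    using n r t by (auto simp: m_def field_simps)
  have p_le: "p i \<le> p j" if "i \<le> j" for i j
    using tm that unfolding p_def by (intro mult_right_mono) auto
  have pm: "p m = t" "p 0 = 0" by (auto simp: p_def m_def)
  show ?thesis
  proof
    show "valid_partition t m p"
      using p_le pm by (auto simp: valid_partition_def intro: mono_onI)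
    fix x assume x: "0 < x" "x \<le> t"
    \<comment> \<open>Written as differences of indicators of half-lines, the indicators of the
      cells telescope to 1.\<close>
    have ind: "indicator {p i<..p (Suc i)} x = (indicator {..p (Suc i)} x - indicator {..p i} x :: real)" for i
      using p_le[of i "Suc i"] by (auto simp: indicator_def)
    have one: "(\<Sum>i<m. indicator {p i<..p (Suc i)} x :: real) = 1"
      unfolding ind using x pm by (subst sum_lessThan_telescope) (auto simp: indicator_def)
    have "\<bar>step_function m p (\<lambda>i. f (p i)) x - f x\<bar>
        = \<bar>\<Sum>i<m. (f (p i) - f x) * indicator {p i<..p (Suc i)} x\<bar>"
      unfolding step_function_def left_diff_distrib sum_subtractf sum_distrib_left[symmetric] one by simp
    also have "\<dots> \<le> (\<Sum>i<m. e * indicator {p i<..p (Suc i)} x)"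
    proof (intro order_trans[OF sum_abs] sum_mono)
      fix i assume i: "i \<in> {..<m}"
      show "\<bar>(f (p i) - f x) * indicator {p i<..p (Suc i)} x\<bar> \<le> e * indicator {p i<..p (Suc i)} x"
      proof (cases "x \<in> {p i<..p (Suc i)}")
        case True
        moreover have "p (Suc i) = p i + t / m" by (simp add: p_def distrib_right add_divide_distrib)
        ultimately have "dist (f (p i)) (f x) < e"
          using x tm p_le[of 0 i] pm by (intro unif) (auto simp: dist_real_def)
        then show ?thesis using True by (simp add: dist_real_def)
      qed simp
    qed
    also have "\<dots> = e" using one by (simp add: sum_distrib_left[symmetric])
    finally show "\<bar>step_function m p (\<lambda>i. f (p i)) x - f x\<bar> \<le> e" .
  qed
qed

text \<open>The finite length t turns uniform bounds into L2 bounds. The bound is asked almost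
  everywhere because step functions miss the point 0.\<close>

lemma bounded_square_integral:
  fixes h :: "real \<Rightarrow> real"
  assumes t: "0 \<le> t" and b: "AE x in restrict_space lborel {0..t}. \<bar>h x\<bar> \<le> b"
    and [measurable]: "h \<in> borel_measurable (restrict_space lborel {0..t})"
  shows "integrable (restrict_space lborel {0..t}) (\<lambda>x. (h x)\<^sup>2)"
    and "(\<integral>x. (h x)\<^sup>2 \<partial>restrict_space lborel {0..t}) \<le> t * b\<^sup>2"
proof -
  let ?L = "restrict_space lborel {0..t}"
  interpret finite_measure ?L
    using t by (intro finite_measureI) (simp add: space_restrict_space emeasure_restrict_space)
  have b2: "AE x in ?L. (h x)\<^sup>2 \<le> b\<^sup>2"
    using b by eventually_elim (metis abs_ge_zero power2_abs power_mono)
  show int: "integrable ?L (\<lambda>x. (h x)\<^sup>2)"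
    using b2 by (intro integrable_const_bound[of _ "b\<^sup>2"]) auto
  then have "(\<integral>x. (h x)\<^sup>2 \<partial>?L) \<le> (\<integral>x. b\<^sup>2 \<partial>?L)"
    using b2 by (intro integral_mono_AE) auto
  also have "\<dots> = t * b\<^sup>2"
    using t by (simp add: measure_restrict_space space_restrict_space)
  finally show "(\<integral>x. (h x)\<^sup>2 \<partial>?L) \<le> t * b\<^sup>2" .
qed

text \<open>Uniform approximation at rate 2^-j makes squared L2 distances of order 4^-j, the rate
  that \<open>L2_fast_Cauchy_convergent\<close> asks for; the isometry carries it over to the step
  integrals.\<close>

lemma has_wiener_integral_continuous:
  fixes f :: "real \<Rightarrow> real"
  assumes W: "standard_brownian_motion M W" and t: "0 \<le> t" and f: "continuous_on {0..t} f"
  shows "\<exists>X. has_wiener_integral M W t f X"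
proof -
  let ?L = "restrict_space lborel {0..t}"
  have "\<exists>m p c. valid_partition t m p \<and> (\<forall>x. 0 < x \<and> x \<le> t \<longrightarrow> \<bar>step_function m p c x - f x\<bar> \<le> (1/2) ^ j)" for j :: nat
    by (rule step_function_approx[OF t f, of "(1/2) ^ j"]) auto
  then obtain m p c where p: "\<And>j. valid_partition t (m j) (p j)"
    and approx: "\<And>j x. 0 < x \<Longrightarrow> x \<le> t \<Longrightarrow> \<bar>step_function (m j) (p j) (c j) x - f x\<bar> \<le> (1/2) ^ j"
    by metis
  define u where "u j = step_function (m j) (p j) (c j)" for j
  have [measurable]: "f \<in> borel_measurable ?L"
    using borel_measurable_continuous_on_restrict[OF f]
    by (simp cong: measurable_cong_sets sets_restrict_space_cong)
  have "AE x in ?L. 0 < x \<and> x \<le> t"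
  proof -
    have "AE x in lborel. x \<noteq> (0::real)" by (rule AE_lborel_singleton)
    then show ?thesis by (subst AE_restrict_space_iff) (auto elim!: eventually_mono)
  qed
  then have bound: "AE x in ?L. \<bar>u j x - f x\<bar> \<le> (1/2) ^ j" for j
    by eventually_elim (auto simp: u_def approx)
  have sq_u: "square_integrable ?L (u j)" for j
    using square_integrable_step_function[of "m j" "p j" "c j"]
      integrable_mult_indicator[of "{0..t}" lborel "\<lambda>x. (step_function (m j) (p j) (c j) x)\<^sup>2"]
    unfolding square_integrable_def u_def
    by (auto intro!: measurable_restrict_space1 simp: integrable_restrict_space)
  note small = bounded_square_integral[OF t]
  have [measurable]: "u j \<in> borel_measurable ?L" for j
    using sq_u by (auto simp: square_integrable_def)
  \<comment> \<open>Square-integrability of f is read off from f = u 0 - (u 0 - f).\<close>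
  have "square_integrable ?L (\<lambda>x. u 0 x - f x)"
    unfolding square_integrable_def using small(1)[OF bound[of 0]] by simp
  then have "square_integrable ?L (\<lambda>x. u 0 x - (u 0 x - f x))"
    by (rule square_integrable_diff[OF sq_u])
  then have sq_f: "square_integrable ?L f" by simp
  have zero: "(\<lambda>j. t * (1/4) ^ j) \<longlonglongrightarrow> 0"
    by (intro tendsto_mult_right_zero LIMSEQ_realpow_zero) auto
  have p4: "((1/2) ^ j)\<^sup>2 = (1/4 :: real) ^ j" for j
    by (simp add: power_mult[symmetric] power_divide mult.commute[of j 2]) (simp add: power_mult)
  have "L2_tendsto ?L u f"
    using small(2)[OF bound] p4 by (intro L2_tendstoI[OF sq_u sq_f _ zero]) simp
  moreover have "\<exists>X. L2_tendsto M (\<lambda>j. step_wiener_integral W (m j) (p j) (c j)) X"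
  proof (rule L2_fast_Cauchy_convergent)
    show "square_integrable M (step_wiener_integral W (m j) (p j) (c j))" for j
      by (rule square_integrable_step_wiener[OF W p])
    fix i j :: nat assume ij: "i \<le> j"
    have "AE x in ?L. \<bar>u j x - u i x\<bar> \<le> 2 * (1/2) ^ i"
      using bound[of i] bound[of j]
    proof eventually_elim
      case (elim x)
      moreover have "(1/2 :: real) ^ j \<le> (1/2) ^ i"
        using ij by (intro power_decreasing) auto
      ultimately show ?case by linarith
    qed
    from small(2)[OF this] have "(\<integral>x. (u j x - u i x)\<^sup>2 \<partial>?L) \<le> t * (2 * (1/2) ^ i)\<^sup>2" by simp
    then show "(\<integral>\<omega>. (step_wiener_integral W (m j) (p j) (c j) \<omega>
        - step_wiener_integral W (m i) (p i) (c i) \<omega>)\<^sup>2 \<partial>M) \<le> 4 * t * (1/4) ^ i"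
      unfolding step_wiener_isometry[OF W p p] u_def by (simp add: power_mult_distrib p4)
  qed
  ultimately show ?thesis
    using p unfolding has_wiener_integral_def u_def valid_partition_def by blast
qed

text \<open>From here on the choice operator denotes an actual integral. Which version it picks is
  immaterial, as \<open>has_wiener_integral_contraction\<close> speaks of arbitrary
  versions.\<close>

lemma has_wiener_integral_wiener_integral:
  fixes f :: "real \<Rightarrow> real"
  assumes "standard_brownian_motion M W" "0 \<le> t" "continuous_on {0..t} f"
  shows "has_wiener_integral M W t f (wiener_integral M W t f)"
  unfolding wiener_integral_def by (rule someI_ex[OF has_wiener_integral_continuous[OF assms]])

subsection \<open>A strong law of large numbers\<close>

lemma power_le_one_plus_power4:
  fixes x :: real
  shows "\<bar>x\<bar> \<le> 1 + x ^ 4" "x\<^sup>2 \<le> 1 + x ^ 4" "\<bar>x\<bar> ^ 3 \<le> 1 + x ^ 4"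
proof -
  have "x ^ 4 = \<bar>x\<bar> ^ 4" "x\<^sup>2 = \<bar>x\<bar> ^ 2"
    by (simp_all add: power_even_abs)
  moreover have "\<bar>x\<bar> ^ k \<le> 1 + \<bar>x\<bar> ^ 4" if "k \<le> 4" for k
  proof (cases "\<bar>x\<bar> \<le> 1")
    case True
    then have "\<bar>x\<bar> ^ k \<le> 1" by (simp add: power_le_one)
    then show ?thesis by (smt (verit) zero_le_power abs_ge_zero)
  next
    case False
    then have "\<bar>x\<bar> ^ k \<le> \<bar>x\<bar> ^ 4" using that by (intro power_increasing) auto
    then show ?thesis by simp
  qed
  from this[of 1] this[of 2] this[of 3]
  have "\<bar>x\<bar> \<le> 1 + \<bar>x\<bar> ^ 4" "\<bar>x\<bar> ^ 2 \<le> 1 + \<bar>x\<bar> ^ 4" "\<bar>x\<bar> ^ 3 \<le> 1 + \<bar>x\<bar> ^ 4" by simp_all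
  ultimately show "\<bar>x\<bar> \<le> 1 + x ^ 4" "x\<^sup>2 \<le> 1 + x ^ 4" "\<bar>x\<bar> ^ 3 \<le> 1 + x ^ 4"
    by simp_all
qed

context prob_space
begin

lemma integrable_powers_of_fourth:
  fixes X :: "'a \<Rightarrow> real"
  assumes [measurable]: "X \<in> borel_measurable M" and X: "integrable M (\<lambda>\<omega>. X \<omega> ^ 4)"
  shows "integrable M X" "integrable M (\<lambda>\<omega>. (X \<omega>)\<^sup>2)" "integrable M (\<lambda>\<omega>. X \<omega> ^ 3)"
proof -
  have int: "integrable M (\<lambda>\<omega>. 1 + X \<omega> ^ 4)" using X by auto
  show "integrable M X" "integrable M (\<lambda>\<omega>. (X \<omega>)\<^sup>2)" "integrable M (\<lambda>\<omega>. X \<omega> ^ 3)"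
    using power_le_one_plus_power4
    by (auto intro!: Bochner_Integration.integrable_bound[OF int] simp: power_abs)
qed

text \<open>Independence factors the mixed terms of the binomial expansion; X^3 S and X S^3 vanish
  with the means, and only 6 X^2 S^2 survives.\<close>

lemma fourth_moment_add_indep:
  fixes X S :: "'a \<Rightarrow> real"
  assumes ind: "indep_var borel X borel S"
    and X4: "integrable M (\<lambda>\<omega>. X \<omega> ^ 4)" and S4: "integrable M (\<lambda>\<omega>. S \<omega> ^ 4)"
    and X0: "expectation X = 0" and S0: "expectation S = 0"
  shows "integrable M (\<lambda>\<omega>. (X \<omega> + S \<omega>) ^ 4)"
    and "expectation (\<lambda>\<omega>. (X \<omega> + S \<omega>) ^ 4) = expectation (\<lambda>\<omega>. X \<omega> ^ 4)
      + 6 * expectation (\<lambda>\<omega>. (X \<omega>)\<^sup>2) * expectation (\<lambda>\<omega>. (S \<omega>)\<^sup>2) + expectation (\<lambda>\<omega>. S \<omega> ^ 4)"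
    and "expectation (\<lambda>\<omega>. (X \<omega> + S \<omega>)\<^sup>2) = expectation (\<lambda>\<omega>. (X \<omega>)\<^sup>2) + expectation (\<lambda>\<omega>. (S \<omega>)\<^sup>2)"
proof -
  have [measurable]: "X \<in> borel_measurable M" "S \<in> borel_measurable M"
    using ind by (auto simp: indep_var_rv1 indep_var_rv2 dest: indep_var_rv1 indep_var_rv2)
  note IX = integrable_powers_of_fourth[OF _ X4, simplified]
    and IS = integrable_powers_of_fourth[OF _ S4, simplified]
  have intp: "integrable M (\<lambda>\<omega>. X \<omega> ^ i)" "integrable M (\<lambda>\<omega>. S \<omega> ^ i)" if "i \<in> {1, 2, 3}" for i
    using that IX IS by auto
  have ind': "indep_var borel (\<lambda>\<omega>. X \<omega> ^ i) borel (\<lambda>\<omega>. S \<omega> ^ j)" for i j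
    using indep_var_compose[OF ind, of "\<lambda>x. x ^ i" borel "\<lambda>x. x ^ j" borel] by (simp add: comp_def)
  have prod: "integrable M (\<lambda>\<omega>. X \<omega> ^ i * S \<omega> ^ j)"
    "expectation (\<lambda>\<omega>. X \<omega> ^ i * S \<omega> ^ j) = expectation (\<lambda>\<omega>. X \<omega> ^ i) * expectation (\<lambda>\<omega>. S \<omega> ^ j)"
    if "i \<in> {1, 2, 3}" "j \<in> {1, 2, 3}" for i j
    using that intp ind' by (auto intro!: indep_var_integrable indep_var_lebesgue_integral)
  note p = prod[of 3 1] prod[of 2 2] prod[of 1 3] prod[of 1 1]
  \<comment> \<open>The exponents 1 are written out so that every mixed term is an instance of
    \<open>prod\<close>.\<close>
  have expand: "(X \<omega> + S \<omega>) ^ 4 = X \<omega> ^ 4 + 4 * (X \<omega> ^ 3 * S \<omega> ^ 1) + 6 * (X \<omega> ^ 2 * S \<omega> ^ 2)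
      + 4 * (X \<omega> ^ 1 * S \<omega> ^ 3) + S \<omega> ^ 4" for \<omega>
    by (simp add: power4_eq_xxxx power3_eq_cube power2_eq_square algebra_simps)
  show "integrable M (\<lambda>\<omega>. (X \<omega> + S \<omega>) ^ 4)"
    unfolding expand using p X4 S4 by auto
  show "expectation (\<lambda>\<omega>. (X \<omega> + S \<omega>) ^ 4) = expectation (\<lambda>\<omega>. X \<omega> ^ 4)
      + 6 * expectation (\<lambda>\<omega>. (X \<omega>)\<^sup>2) * expectation (\<lambda>\<omega>. (S \<omega>)\<^sup>2) + expectation (\<lambda>\<omega>. S \<omega> ^ 4)"
    unfolding expand using p X4 S4 X0 S0 by simp
  have "(X \<omega> + S \<omega>)\<^sup>2 = (X \<omega>)\<^sup>2 + 2 * (X \<omega> ^ 1 * S \<omega> ^ 1) + (S \<omega>)\<^sup>2" for \<omega>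
    by (simp add: power2_eq_square algebra_simps)
  then show "expectation (\<lambda>\<omega>. (X \<omega> + S \<omega>)\<^sup>2) = expectation (\<lambda>\<omega>. (X \<omega>)\<^sup>2) + expectation (\<lambda>\<omega>. (S \<omega>)\<^sup>2)"
    using p IX IS X0 S0 by simp
qed

text \<open>Second and fourth moments go through one induction: the variance of the sum grows at
  most like n, so a new summand adds O(n) to the fourth moment, which makes O(n^2) in total.\<close>

lemma centered_sum_fourth_moment:
  fixes X :: "nat \<Rightarrow> 'a \<Rightarrow> real"
  assumes ind: "indep_vars (\<lambda>_. borel) X {1..}"
    and X4: "\<And>k. 1 \<le> k \<Longrightarrow> integrable M (\<lambda>\<omega>. X k \<omega> ^ 4)"
    and X0: "\<And>k. 1 \<le> k \<Longrightarrow> expectation (X k) = 0"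
    and V: "\<And>k. 1 \<le> k \<Longrightarrow> expectation (\<lambda>\<omega>. (X k \<omega>)\<^sup>2) \<le> v"
    and K: "\<And>k. 1 \<le> k \<Longrightarrow> expectation (\<lambda>\<omega>. X k \<omega> ^ 4) \<le> \<kappa>"
  shows "integrable M (\<lambda>\<omega>. (\<Sum>k=1..n. X k \<omega>) ^ 4)"
    and "expectation (\<lambda>\<omega>. (\<Sum>k=1..n. X k \<omega>) ^ 4) \<le> (\<kappa> + 6 * v\<^sup>2) * (real n)\<^sup>2"
proof -
  have [measurable]: "X k \<in> borel_measurable M" if "1 \<le> k" for k
    using ind that by (auto simp: indep_vars_def)
  have IX: "integrable M (X k)" if "1 \<le> k" for k
    using integrable_powers_of_fourth[of "X k"] X4 that by auto
  have v: "0 \<le> v" using V[of 1] by (smt (verit) integral_nonneg_AE AE_I2 le_refl zero_le_power2)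
  have k: "0 \<le> \<kappa>"
    by (rule order_trans[OF _ K[of 1]]) (auto intro!: integral_nonneg_AE)
  define S where "S n \<omega> = (\<Sum>k=1..n. X k \<omega>)" for n \<omega>
  have "integrable M (\<lambda>\<omega>. S n \<omega> ^ 4) \<and> expectation (S n) = 0
      \<and> expectation (\<lambda>\<omega>. (S n \<omega>)\<^sup>2) \<le> v * real n
      \<and> expectation (\<lambda>\<omega>. S n \<omega> ^ 4) \<le> (\<kappa> + 6 * v\<^sup>2) * (real n)\<^sup>2" for n
  proof (induction n)
    case 0
    then show ?case by (simp add: S_def[abs_def])
  next
    case (Suc n)
    have step: "S (Suc n) = (\<lambda>\<omega>. X (Suc n) \<omega> + S n \<omega>)"
      by (auto simp: S_def)
    have ind_n: "indep_var borel (X (Suc n)) borel (S n)"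
      unfolding S_def[abs_def]
      by (rule indep_vars_sum) (auto intro: indep_vars_subset[OF ind])
    have S: "integrable M (\<lambda>\<omega>. S n \<omega> ^ 4)" "expectation (S n) = 0"
      "expectation (\<lambda>\<omega>. (S n \<omega>)\<^sup>2) \<le> v * real n"
      "expectation (\<lambda>\<omega>. S n \<omega> ^ 4) \<le> (\<kappa> + 6 * v\<^sup>2) * (real n)\<^sup>2"
      using Suc by auto
    have "1 \<le> Suc n" by simp
    note F = fourth_moment_add_indep[OF ind_n X4[OF this] S(1) X0[OF this] S(2)]
    have "expectation (\<lambda>\<omega>. (X (Suc n) \<omega>)\<^sup>2) * expectation (\<lambda>\<omega>. (S n \<omega>)\<^sup>2) \<le> v * (v * real n)"
      using V[of "Suc n"] S v by (intro mult_mono) (auto intro!: integral_nonneg_AE)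
    then have "expectation (\<lambda>\<omega>. S (Suc n) \<omega> ^ 4)
        \<le> \<kappa> + 6 * (v * (v * real n)) + (\<kappa> + 6 * v\<^sup>2) * (real n)\<^sup>2"
      unfolding step F(2) using K[of "Suc n"] S(4) by simp
    \<comment> \<open>The increase (n + 1)^2 - n^2 = 2 n + 1 pays for \<kappa> + 6 v^2 n.\<close>
    also have "\<dots> \<le> (\<kappa> + 6 * v\<^sup>2) * (real (Suc n))\<^sup>2"
    proof -
      have "0 \<le> \<kappa> * real n" "0 \<le> v * v * real n" "0 \<le> v * v" using k v by auto
      then show ?thesis by (simp add: power2_eq_square algebra_simps)
    qed
    finally have "expectation (\<lambda>\<omega>. S (Suc n) \<omega> ^ 4) \<le> (\<kappa> + 6 * v\<^sup>2) * (real (Suc n))\<^sup>2" .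
    moreover have "integrable M (\<lambda>\<omega>. S (Suc n) \<omega> ^ 4)"
      unfolding step by (rule F(1))
    moreover have "expectation (\<lambda>\<omega>. (S (Suc n) \<omega>)\<^sup>2) \<le> v * real (Suc n)"
      unfolding step F(3) using V[of "Suc n"] S(3)
      by (simp add: algebra_simps)
    moreover have "expectation (S (Suc n)) = 0"
    proof -
      have "integrable M (S n)"
        unfolding S_def[abs_def] using IX by (intro Bochner_Integration.integrable_sum) auto
      then show ?thesis
        unfolding step using S(2) X0[of "Suc n"] IX[of "Suc n"] by simp
    qed
    ultimately show ?case by blast
  qed
  then show "integrable M (\<lambda>\<omega>. (\<Sum>k=1..n. X k \<omega>) ^ 4)"
    "expectation (\<lambda>\<omega>. (\<Sum>k=1..n. X k \<omega>) ^ 4) \<le> (\<kappa> + 6 * v\<^sup>2) * (real n)\<^sup>2"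
    by (auto simp: S_def)
qed

text \<open>The bound \<open>E(S\<^sub>n/n)\<^sup>4 = O(n\<^sup>-\<^sup>2)\<close> makes \<open>\<Sum>\<^sub>n (S\<^sub>n/n)\<^sup>4\<close> almost surely finite.\<close>

theorem strong_law_fourth_moment:
  fixes X :: "nat \<Rightarrow> 'a \<Rightarrow> real"
  assumes ind: "indep_vars (\<lambda>_. borel) X {1..}"
    and X4: "\<And>k. 1 \<le> k \<Longrightarrow> integrable M (\<lambda>\<omega>. X k \<omega> ^ 4)"
    and mean: "\<And>k. 1 \<le> k \<Longrightarrow> expectation (X k) = m"
    and V: "\<And>k. 1 \<le> k \<Longrightarrow> expectation (\<lambda>\<omega>. (X k \<omega> - m)\<^sup>2) \<le> v"
    and K: "\<And>k. 1 \<le> k \<Longrightarrow> expectation (\<lambda>\<omega>. (X k \<omega> - m) ^ 4) \<le> \<kappa>"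
  shows "AE \<omega> in M. (\<lambda>n. 1 / real n * (\<Sum>k=1..n. X k \<omega>)) \<longlonglongrightarrow> m"
proof -
  have [measurable]: "X k \<in> borel_measurable M" if "1 \<le> k" for k
    using ind that by (auto simp: indep_vars_def)
  note IX = integrable_powers_of_fourth[OF _ X4]
  define Y where "Y k \<omega> = X k \<omega> - m" for k \<omega>
  have indY: "indep_vars (\<lambda>_. borel) Y {1..}"
    unfolding Y_def[abs_def] by (rule indep_vars_compose2[OF ind]) auto
  have Y4: "integrable M (\<lambda>\<omega>. Y k \<omega> ^ 4)" if "1 \<le> k" for k
  proof -
    have "Y k \<omega> ^ 4 = X k \<omega> ^ 4 - 4 * m * X k \<omega> ^ 3 + 6 * m\<^sup>2 * (X k \<omega>)\<^sup>2 - 4 * m ^ 3 * X k \<omega> + m ^ 4" for \<omega>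
      by (simp add: Y_def power4_eq_xxxx power3_eq_cube power2_eq_square algebra_simps)
    then show ?thesis using IX[of k] X4[of k] that by simp
  qed
  have Y0: "expectation (Y k) = 0" if "1 \<le> k" for k
    using IX[of k] mean[of k] that by (simp add: Y_def[abs_def] prob_space)
  define C where "C = \<kappa> + 6 * v\<^sup>2"
  note S = centered_sum_fourth_moment[OF indY Y4 Y0 V[folded Y_def] K[folded Y_def], folded C_def]
  have "AE \<omega> in M. summable (\<lambda>n. (1 / real n * (\<Sum>k=1..n. Y k \<omega>)) ^ 4)"
  proof (rule AE_summable_of_summable_integral)
    show "integrable M (\<lambda>\<omega>. (1 / real n * (\<Sum>k=1..n. Y k \<omega>)) ^ 4)" for n
      using S(1)[of n] by (simp only: power_mult_distrib integrable_mult_right)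
    show "summable (\<lambda>n. expectation (\<lambda>\<omega>. (1 / real n * (\<Sum>k=1..n. Y k \<omega>)) ^ 4))"
    proof (rule summable_comparison_test')
      show "summable (\<lambda>n. C * inverse ((real n)\<^sup>2))"
        by (intro summable_mult inverse_power_summable) auto
      fix n :: nat
      have "expectation (\<lambda>\<omega>. (1 / real n * (\<Sum>k=1..n. Y k \<omega>)) ^ 4) \<le> (1 / real n) ^ 4 * (C * (real n)\<^sup>2)"
        unfolding power_mult_distrib integral_mult_right_zero using S(2)[of n] by (intro mult_left_mono) auto
      also have "\<dots> = C * inverse ((real n)\<^sup>2)"
        by (cases "n = 0") (auto simp: field_simps power4_eq_xxxx power2_eq_square)
      finally show "norm (expectation (\<lambda>\<omega>. (1 / real n * (\<Sum>k=1..n. Y k \<omega>)) ^ 4)) \<le> C * inverse ((real n)\<^sup>2)"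
        by (simp add: integral_nonneg_AE)
    qed
  qed auto
  then show ?thesis
  proof eventually_elim
    case (elim \<omega>)
    then have "(\<lambda>n. (1 / real n * (\<Sum>k=1..n. Y k \<omega>)) ^ 4) \<longlonglongrightarrow> 0"
      by (rule summable_LIMSEQ_zero)
    then have "(\<lambda>n. root 4 ((1 / real n * (\<Sum>k=1..n. Y k \<omega>)) ^ 4)) \<longlonglongrightarrow> root 4 0"
      by (rule tendsto_real_root)
    moreover have "root 4 (x ^ 4) = \<bar>x\<bar>" for x :: real
      using real_root_power_cancel[of 4 "\<bar>x\<bar>"] by simp
    ultimately have "(\<lambda>n. \<bar>1 / real n * (\<Sum>k=1..n. Y k \<omega>)\<bar>) \<longlonglongrightarrow> 0"
      by (simp only: real_root_zero)
    then have "(\<lambda>n. 1 / real n * (\<Sum>k=1..n. Y k \<omega>)) \<longlonglongrightarrow> 0"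
      by (rule tendsto_rabs_zero_cancel)
    then have "(\<lambda>n. 1 / real n * (\<Sum>k=1..n. Y k \<omega>) + m) \<longlonglongrightarrow> 0 + m"
      by (intro tendsto_intros)
    \<comment> \<open>Restricted to n > 0: at n = 0 the left-hand side is m and the right-hand side
      0.\<close>
    moreover have "\<forall>\<^sub>F n in sequentially. 1 / real n * (\<Sum>k=1..n. Y k \<omega>) + m = 1 / real n * (\<Sum>k=1..n. X k \<omega>)"
      using eventually_gt_at_top[of 0]
      by eventually_elim (simp add: Y_def sum_subtractf field_simps)
    ultimately show ?case by (simp add: tendsto_cong)
  qed
qed

end

subsection \<open>Mittag-Leffler type series\<close>

lemma pos_not_nonpos_Int:
  fixes x :: real
  assumes "0 < x"
  shows "x \<notin> \<int>\<^sub>\<le>\<^sub>0"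
  using assms by auto

text \<open>Gauss's limit for the Gamma function: B(m + 1, s) equals m! divided by the Pochhammer
  symbol of s of length m + 1, which is \<open>Gamma_series s m\<close> times m^-s, and
  \<open>Gamma_series s m\<close> converges to \<open>Gamma s\<close>.\<close>

lemma Beta_pos_tendsto_0:
  fixes s :: real
  assumes s: "0 < s"
  shows "(\<lambda>m. Beta (real m + 1) s) \<longlonglongrightarrow> 0"
proof -
  have "(\<lambda>m. Gamma_series s m * real m powr (-s)) \<longlonglongrightarrow> Gamma s * 0"
    using s by (intro tendsto_mult Gamma_series_LIMSEQ tendsto_neg_powr filterlim_real_sequentially) simp
  moreover have "\<forall>\<^sub>F m in sequentially. Gamma_series s m * real m powr (-s) = Beta (real m + 1) s"
    using eventually_gt_at_top[of 0]
  proof eventually_elim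
    case (elim m)
    have "real m powr (-s) * exp (s * ln (real m)) = 1"
      using elim by (simp add: powr_def flip: exp_add)
    moreover have "Beta (real m + 1) s = fact m / pochhammer s (Suc m)"
      using pochhammer_Gamma[OF pos_not_nonpos_Int[OF s], of "Suc m"] Gamma_real_pos[OF s]
      by (simp add: Beta_def Gamma_fact add_ac)
    ultimately show ?case
      by (simp add: Gamma_series_def mult_ac)
  qed
  ultimately show ?thesis by (simp add: tendsto_cong)
qed

text \<open>With \<open>x = m\<rho> + 1\<close>, this uses \<open>\<Gamma>(x) \<Gamma>(\<rho>) / \<Gamma>(x + \<rho>) = B(x, \<rho>)\<close>
  and \<open>x B(x, \<rho>) = (\<rho> - 1) B(x + 1, \<rho> - 1)\<close>, which is where \<open>\<rho> > 1\<close> enters.\<close>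

lemma Gamma_ratio_tendsto_0:
  fixes \<rho> :: real
  assumes \<rho>: "1 < \<rho>"
  shows "(\<lambda>m. real (Suc m) * (Gamma (real m * \<rho> + 1) / Gamma (real (Suc m) * \<rho> + 1))) \<longlonglongrightarrow> 0"
proof (rule tendsto_sandwich[OF _ _ tendsto_const])
  have pos: "0 < real m * \<rho> + 1" for m
    using \<rho> by (intro add_nonneg_pos) auto
  show "\<forall>\<^sub>F m in sequentially. 0 \<le> real (Suc m) * (Gamma (real m * \<rho> + 1) / Gamma (real (Suc m) * \<rho> + 1))"
    by (intro always_eventually allI mult_nonneg_nonneg divide_nonneg_nonneg less_imp_le[OF Gamma_real_pos[OF pos]]) simp
  have "real (Suc m) * (Gamma (real m * \<rho> + 1) / Gamma (real (Suc m) * \<rho> + 1))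
      \<le> ((\<rho> - 1) / Gamma \<rho>) * Beta (real m + 1) (\<rho> - 1)" for m
  proof -
    define x where "x = real m * \<rho> + 1"
    have x: "0 < x" "real (Suc m) \<le> x"
      using pos[of m] \<rho> by (auto simp: x_def mult_left_mono[of 1 \<rho> "real m", simplified])
    have G: "0 < Gamma x" "0 < Gamma (x + \<rho>)" "0 < Gamma \<rho>" "0 < Gamma (\<rho> - 1)"
      using x \<rho> by auto
    then have ne: "Gamma (\<rho> - 1) \<noteq> 0" by simp
    have rec: "Gamma (x + 1) = x * Gamma x" "Gamma \<rho> = (\<rho> - 1) * Gamma (\<rho> - 1)"
      using Gamma_plus1[OF pos_not_nonpos_Int[OF x(1)]] Gamma_plus1[OF pos_not_nonpos_Int, of "\<rho> - 1"] \<rho> by simp_all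
    have "real (Suc m) * (Gamma x / Gamma (x + \<rho>)) \<le> x * (Gamma x / Gamma (x + \<rho>))"
      using x G by (intro mult_right_mono) auto
    also have "\<dots> = ((\<rho> - 1) / Gamma \<rho>) * Beta (x + 1) (\<rho> - 1)"
      using ne \<rho> by (simp add: Beta_def rec)
    \<comment> \<open>Beta decreases in its first argument; the passage to an integer argument makes
      \<open>Beta_pos_tendsto_0\<close> applicable.\<close>
    also have "\<dots> \<le> ((\<rho> - 1) / Gamma \<rho>) * Beta (real m + 1) (\<rho> - 1)"
      using x G \<rho> by (intro mult_left_mono Beta_real_mono) auto
    finally show ?thesis
      by (simp add: x_def algebra_simps)
  qed
  then show "\<forall>\<^sub>F m in sequentially. real (Suc m) * (Gamma (real m * \<rho> + 1) / Gamma (real (Suc m) * \<rho> + 1))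
      \<le> ((\<rho> - 1) / Gamma \<rho>) * Beta (real m + 1) (\<rho> - 1)"
    by auto
  show "(\<lambda>m. ((\<rho> - 1) / Gamma \<rho>) * Beta (real m + 1) (\<rho> - 1)) \<longlonglongrightarrow> 0"
    using \<rho> by (intro tendsto_mult_right_zero Beta_pos_tendsto_0) auto
qed

lemma Gamma_mult_add1_pos:
  fixes \<rho> :: real
  assumes "1 < \<rho>"
  shows "0 < Gamma (real m * \<rho> + 1)"
  using assms by (intro Gamma_real_pos add_nonneg_pos) auto

text \<open>Consecutive terms have a ratio equal in absolute value to |z| times the quantity in
  \<open>Gamma_ratio_tendsto_0\<close>. The factor m! is included because, up to a geometric factor,
  it dominates the Pochhammer symbols, and because it permits the comparison of
  \<open>mittag_leffler\<close> with the exponential series.\<close>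

lemma summable_fact_power_div_Gamma:
  fixes \<rho> z :: real
  assumes \<rho>: "1 < \<rho>"
  shows "summable (\<lambda>m. fact m * z ^ m / Gamma (real m * \<rho> + 1))"
proof -
  let ?r = "\<lambda>m. real (Suc m) * (Gamma (real m * \<rho> + 1) / Gamma (real (Suc m) * \<rho> + 1))"
  have "(\<lambda>m. \<bar>z\<bar> * ?r m) \<longlonglongrightarrow> 0"
    by (intro tendsto_mult_right_zero Gamma_ratio_tendsto_0 \<rho>)
  then have "\<forall>\<^sub>F m in sequentially. \<bar>z\<bar> * ?r m < 1/2"
    by (rule order_tendstoD) simp
  then obtain N where N: "\<And>m. N \<le> m \<Longrightarrow> \<bar>z\<bar> * ?r m < 1/2"
    by (auto simp: eventually_sequentially)
  show ?thesis
  proof (rule summable_ratio_test[of "1/2" N])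
    fix m assume m: "N \<le> m"
    define a b where "a = Gamma (real m * \<rho> + 1)" and "b = Gamma (real (Suc m) * \<rho> + 1)"
    have ab: "0 < a" "0 < b" using Gamma_mult_add1_pos[OF \<rho>] by (simp_all only: a_def b_def)
    have "norm (fact (Suc m) * z ^ Suc m / b) = (\<bar>z\<bar> * (real (Suc m) * (a / b))) * norm (fact m * z ^ m / a)"
      using ab by (simp add: abs_mult power_abs del: of_nat_Suc)
    also have "\<dots> \<le> 1/2 * norm (fact m * z ^ m / a)"
      using N[OF m] by (intro mult_right_mono) (auto simp: a_def b_def)
    finally show "norm (fact (Suc m) * z ^ Suc m / Gamma (real (Suc m) * \<rho> + 1))
        \<le> 1/2 * norm (fact m * z ^ m / Gamma (real m * \<rho> + 1))"
      by (simp only: a_def b_def)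
  qed simp
qed

text \<open>Factor by factor, \<mu> + k \<le> max 1 \<mu> * (1 + k). The resulting geometric factor
  is absorbed into the argument of the power series.\<close>

lemma pochhammer_le_power_fact:
  fixes \<mu> :: real
  assumes "0 < \<mu>"
  shows "pochhammer \<mu> k \<le> max 1 \<mu> ^ k * fact k"
proof (induction k)
  case (Suc k)
  have "\<mu> + real k \<le> max 1 \<mu> * (1 + real k)"
    using mult_right_mono[of 1 "max 1 \<mu>" "real k"] by (simp add: distrib_left)
  with Suc have "pochhammer \<mu> k * (\<mu> + real k) \<le> (max 1 \<mu> ^ k * fact k) * (max 1 \<mu> * (1 + real k))"
    using assms by (intro mult_mono) auto
  then show ?case by (simp add: pochhammer_Suc mult_ac)
qed simp

lemma summable_G_function:
  fixes \<rho> \<mu> z :: real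
  assumes \<rho>: "1 < \<rho>" and \<mu>: "0 < \<mu>"
  shows "summable (\<lambda>k. pochhammer \<mu> k / Gamma (real k * \<rho> + 1) * z ^ k)"
proof (rule summable_comparison_test')
  show "summable (\<lambda>k. fact k * (max 1 \<mu> * \<bar>z\<bar>) ^ k / Gamma (real k * \<rho> + 1))"
    by (rule summable_fact_power_div_Gamma[OF \<rho>])
  fix k :: nat
  have "norm (pochhammer \<mu> k / Gamma (real k * \<rho> + 1) * z ^ k)
      = pochhammer \<mu> k * (\<bar>z\<bar> ^ k / Gamma (real k * \<rho> + 1))"
    using Gamma_mult_add1_pos[OF \<rho>, of k] pochhammer_pos[OF \<mu>, of k] by (simp add: abs_mult power_abs)
  also have "\<dots> \<le> (max 1 \<mu> ^ k * fact k) * (\<bar>z\<bar> ^ k / Gamma (real k * \<rho> + 1))"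
    using Gamma_mult_add1_pos[OF \<rho>, of k] by (intro mult_right_mono pochhammer_le_power_fact \<mu>) auto
  finally show "norm (pochhammer \<mu> k / Gamma (real k * \<rho> + 1) * z ^ k)
      \<le> fact k * (max 1 \<mu> * \<bar>z\<bar>) ^ k / Gamma (real k * \<rho> + 1)"
    by (simp add: power_mult_distrib mult_ac)
qed

lemma isCont_G_function:
  fixes \<rho> \<mu> z :: real
  assumes "1 < \<rho>" "0 < \<mu>"
  shows "isCont (G_function \<rho> \<mu>) z"
  unfolding G_function_def[abs_def]
  by (rule isCont_powser_converges_everywhere) (rule summable_G_function[OF assms])

definition mittag_leffler :: "real \<Rightarrow> real \<Rightarrow> real" where
  "mittag_leffler \<rho> z = (\<Sum>k. z ^ k / Gamma (real k * \<rho> + 1))"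

lemma summable_mittag_leffler:
  fixes \<rho> z :: real
  assumes \<rho>: "1 < \<rho>"
  shows "summable (\<lambda>k. z ^ k / Gamma (real k * \<rho> + 1))"
proof (rule summable_comparison_test')
  show "summable (\<lambda>k. fact k * \<bar>z\<bar> ^ k / Gamma (real k * \<rho> + 1))"
    by (rule summable_fact_power_div_Gamma[OF \<rho>])
  fix k :: nat
  have "1 * \<bar>z\<bar> ^ k \<le> fact k * \<bar>z\<bar> ^ k"
    by (intro mult_right_mono) auto
  then show "norm (z ^ k / Gamma (real k * \<rho> + 1)) \<le> fact k * \<bar>z\<bar> ^ k / Gamma (real k * \<rho> + 1)"
    using Gamma_mult_add1_pos[OF \<rho>, of k] by (simp add: power_abs divide_right_mono)
qed

lemma isCont_mittag_leffler:
  fixes \<rho> z :: real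
  assumes "1 < \<rho>"
  shows "isCont (mittag_leffler \<rho>) z"
proof -
  have "isCont (\<lambda>z. \<Sum>k. inverse (Gamma (real k * \<rho> + 1)) * z ^ k) z"
    using summable_mittag_leffler[OF assms]
    by (intro isCont_powser_converges_everywhere) (simp add: field_simps)
  then show ?thesis
    by (simp add: mittag_leffler_def[abs_def] field_simps)
qed

text \<open>Since \<open>\<rho> > 1\<close>, \<open>E\<^sub>\<rho>\<close> has order less than 1.\<close>

lemma mittag_leffler_exp_bound:
  fixes \<rho> b c :: real
  assumes \<rho>: "1 < \<rho>" and b: "0 < b" and c: "0 \<le> c"
  obtains C where "0 \<le> C" "\<And>x. 0 \<le> x \<Longrightarrow> mittag_leffler \<rho> (c * x) \<le> C * exp (b * x)"
proof -
  \<comment> \<open>The terms of a convergent series are bounded. With the argument c / b this bound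
    compares the k-th term of \<open>mittag_leffler \<rho> (c * x)\<close> with C times that of
    \<open>exp (b * x)\<close>.\<close>
  have "(\<lambda>k. fact k * (c / b) ^ k / Gamma (real k * \<rho> + 1)) \<longlonglongrightarrow> 0"
    by (rule summable_LIMSEQ_zero[OF summable_fact_power_div_Gamma[OF \<rho>]])
  then have "Bseq (\<lambda>k. fact k * (c / b) ^ k / Gamma (real k * \<rho> + 1))"
    by (intro convergent_imp_Bseq convergentI)
  then obtain C where C: "0 < C" "\<And>k. norm (fact k * (c / b) ^ k / Gamma (real k * \<rho> + 1)) \<le> C"
    by (auto simp: Bseq_def)
  show ?thesis
  proof
    fix x :: real assume x: "0 \<le> x"
    have "mittag_leffler \<rho> (c * x) \<le> (\<Sum>k. C * ((b * x) ^ k /\<^sub>R fact k))"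
      unfolding mittag_leffler_def
    proof (rule suminf_le)
      fix k
      have "(c * x) ^ k / Gamma (real k * \<rho> + 1)
          = (fact k * (c / b) ^ k / Gamma (real k * \<rho> + 1)) * ((b * x) ^ k /\<^sub>R fact k)"
        using b by (simp add: power_mult_distrib power_divide field_simps)
      also have "\<dots> \<le> C * ((b * x) ^ k /\<^sub>R fact k)"
        using b x by (intro mult_right_mono order_trans[OF abs_ge_self C(2)[unfolded real_norm_def]]) auto
      finally show "(c * x) ^ k / Gamma (real k * \<rho> + 1) \<le> C * ((b * x) ^ k /\<^sub>R fact k)" .
    qed (rule summable_mittag_leffler[OF \<rho>], rule summable_mult, rule summable_exp_generic)
    also have "\<dots> = C * exp (b * x)"
      unfolding exp_def by (rule suminf_mult[OF summable_exp_generic])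
    finally show "mittag_leffler \<rho> (c * x) \<le> C * exp (b * x)" .
  qed (use C in auto)
qed

section \<open>Fractional integration of powers\<close>

lemma continuous_on_g_kernel:
  assumes "1 < \<rho>"
  shows "continuous_on {0..t} (\<lambda>\<tau>. g_kernel \<rho> (t - \<tau>))"
proof -
  have "continuous_on {0..t} (\<lambda>\<tau>. (t - \<tau>) powr (\<rho> - 1))"
    using assms by (intro continuous_on_powr') (auto intro!: continuous_intros)
  then show ?thesis
    unfolding g_kernel_def divide_inverse by (intro continuous_on_mult continuous_on_const)
qed

lemma continuous_on_powr_pos_exponent:
  fixes \<rho> :: real
  assumes "0 < \<rho>" "A \<subseteq> {0..}"
  shows "continuous_on A (\<lambda>t. t powr \<rho>)"
  using assms by (intro continuous_on_powr') (auto intro!: continuous_intros)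

lemma set_integrable_g_kernel_power:
  assumes "1 < \<rho>"
  shows "set_integrable lborel {0..t} (\<lambda>\<tau>. g_kernel \<rho> (t - \<tau>) * (\<tau> powr \<rho>) ^ k)"
  using assms
  by (intro borel_integrable_atLeastAtMost' continuous_on_mult continuous_on_power
      continuous_on_g_kernel continuous_on_powr_pos_exponent) auto

text \<open>Euler's Beta integral, rescaled from [0, 1] to [0, t]. Read with the Gamma factor on the
  left, it says that convolution with \<open>g_kernel\<close> sends the k-th term of the
  Mittag-Leffler series to the next one.\<close>

lemma g_kernel_convolution_power:
  fixes \<rho> t :: real
  assumes \<rho>: "1 < \<rho>" and t: "0 \<le> t"
  shows "(LBINT \<tau>:{0..t}. g_kernel \<rho> (t - \<tau>) * (\<tau> powr \<rho>) ^ k)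
    = Gamma (real k * \<rho> + 1) * ((t powr \<rho>) ^ Suc k / Gamma (real (Suc k) * \<rho> + 1))"
proof (cases "t = 0")
  case True
  then show ?thesis
    using set_borel_integral_eq_integral(2)[OF set_integrable_g_kernel_power[OF \<rho>, of t k]] by simp
next
  case False
  then have t: "0 < t" using t by simp
  define x where "x = real k * \<rho> + 1"
  have x: "0 < x" using \<rho> by (auto simp: x_def intro: add_nonneg_pos)
  have G: "Gamma \<rho> \<noteq> 0"
    using Gamma_real_pos[of \<rho>] \<rho> by linarith
  have image: "(\<lambda>u. u * t) ` {0..1} = {0..t}"
    using image_mult_atLeastAtMost[OF t, of 0 1] by (simp add: mult.commute[of _ t])
  have "((\<lambda>u. u powr (x - 1) * (1 - u) powr (\<rho> - 1)) has_integral Beta x \<rho>) {0..1}"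
    using x \<rho> by (intro has_integral_Beta_real) auto
  then have "((\<lambda>\<tau>. (\<tau> / t) powr (x - 1) * (1 - \<tau> / t) powr (\<rho> - 1)) has_integral t * Beta x \<rho>) {0..t}"
    using has_integral_stretch_real[of "\<lambda>u. u powr (x - 1) * (1 - u) powr (\<rho> - 1)" _ 0 1 "1 / t"] t image
    by simp
  then have "((\<lambda>\<tau>. (t powr (x + \<rho> - 2) / Gamma \<rho>) * ((\<tau> / t) powr (x - 1) * (1 - \<tau> / t) powr (\<rho> - 1)))
      has_integral (t powr (x + \<rho> - 2) / Gamma \<rho>) * (t * Beta x \<rho>)) {0..t}"
    by (rule has_integral_mult_right)
  moreover have "(t powr (x + \<rho> - 2) / Gamma \<rho>) * (t * Beta x \<rho>)
      = Gamma (real k * \<rho> + 1) * ((t powr \<rho>) ^ Suc k / Gamma (real (Suc k) * \<rho> + 1))"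
  proof -
    have "t powr (x + \<rho> - 2) * t = t powr (x + \<rho> - 1)"
      using t by (simp add: powr_mult_base mult.commute)
    also have "\<dots> = (t powr \<rho>) ^ Suc k"
      using t by (simp add: x_def powr_powr powr_add flip: powr_realpow) (simp add: powr_add algebra_simps)
    finally have "(t powr (x + \<rho> - 2) / Gamma \<rho>) * (t * Beta x \<rho>)
        = (t powr \<rho>) ^ Suc k * (Gamma x / Gamma (x + \<rho>))"
      using G by (simp add: Beta_def field_simps)
    then show ?thesis by (simp add: x_def algebra_simps)
  qed
  \<comment> \<open>The point 0 is left out: for k = 0 the power \<open>(0 powr \<rho>) ^ 0\<close>
    is 1, whereas \<open>0 powr 0\<close> is 0. A single point does not affect the integral.\<close>
  moreover have "(t powr (x + \<rho> - 2) / Gamma \<rho>) * ((\<tau> / t) powr (x - 1) * (1 - \<tau> / t) powr (\<rho> - 1))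
      = g_kernel \<rho> (t - \<tau>) * (\<tau> powr \<rho>) ^ k" if \<tau>: "\<tau> \<in> {0<..t}" for \<tau>
  proof -
    have "1 - \<tau> / t = (t - \<tau>) / t" using t by (simp add: field_simps)
    moreover have "(\<tau> / t) powr (x - 1) = \<tau> powr (x - 1) / t powr (x - 1)"
      "((t - \<tau>) / t) powr (\<rho> - 1) = (t - \<tau>) powr (\<rho> - 1) / t powr (\<rho> - 1)"
      using t \<tau> by (simp_all add: powr_divide)
    moreover have "t powr (x + \<rho> - 2) = t powr (x - 1) * t powr (\<rho> - 1)"
      by (simp flip: powr_add)
    moreover have "(\<tau> powr \<rho>) ^ k = \<tau> powr (x - 1)"
      using \<tau> by (simp add: x_def powr_powr mult.commute flip: powr_realpow)
    ultimately show ?thesis using t by (simp add: g_kernel_def)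
  qed
  ultimately have "((\<lambda>\<tau>. g_kernel \<rho> (t - \<tau>) * (\<tau> powr \<rho>) ^ k) has_integral
      Gamma (real k * \<rho> + 1) * ((t powr \<rho>) ^ Suc k / Gamma (real (Suc k) * \<rho> + 1))) {0..t}"
    by (subst has_integral_spike_finite_eq[of "{0}", symmetric, rotated]) auto
  then show ?thesis
    unfolding set_borel_integral_eq_integral(2)[OF set_integrable_g_kernel_power[OF \<rho>]]
    by (rule integral_unique)
qed

subsection \<open>The scalar resolvent\<close>

definition resolvent_series :: "real \<Rightarrow> real \<Rightarrow> real \<Rightarrow> real" where
  "resolvent_series \<rho> \<alpha> t = (if t < 0 then 0 else mittag_leffler \<rho> (- \<alpha> * t powr \<rho>))"

text \<open>Convolution shifts the series by one index and the factor -\<alpha> completes the power,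
  so -\<alpha> times the convolution is the series without its constant term 1.\<close>

lemma is_scalar_resolvent_series:
  fixes \<rho> \<alpha> :: real
  assumes \<rho>: "1 < \<rho>"
  shows "is_scalar_resolvent \<rho> \<alpha> (resolvent_series \<rho> \<alpha>)"
  unfolding is_scalar_resolvent_def
proof (intro conjI allI impI)
  have cont: "continuous_on UNIV (mittag_leffler \<rho>)"
    using isCont_mittag_leffler[OF \<rho>] by (simp add: continuous_on_eq_continuous_at)
  have "continuous_on {0..} (\<lambda>t. mittag_leffler \<rho> (- \<alpha> * t powr \<rho>))"
  proof (rule continuous_on_compose2[OF cont])
    show "continuous_on {0..} (\<lambda>t. - \<alpha> * t powr \<rho>)"
      using \<rho> by (intro continuous_on_mult continuous_on_const continuous_on_powr_pos_exponent) auto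
  qed simp
  then show "continuous_on {0..} (resolvent_series \<rho> \<alpha>)"
    by (rule continuous_on_eq) (auto simp: resolvent_series_def)
  show "resolvent_series \<rho> \<alpha> t = 0" if "t < 0" for t
    using that by (simp add: resolvent_series_def)
  fix t :: real assume t: "0 \<le> t"
  define f where "f k \<tau> = indicator {0..t} \<tau> *\<^sub>R (g_kernel \<rho> (t - \<tau>) * (\<tau> powr \<rho>) ^ k)" for k \<tau>
  define w where "w k = (- \<alpha>) ^ k / Gamma (real k * \<rho> + 1)" for k
  define J where "J k = (t powr \<rho>) ^ Suc k / Gamma (real (Suc k) * \<rho> + 1)" for k
  have f: "integrable lborel (f k)" for k
    using set_integrable_g_kernel_power[OF \<rho>, of t k] by (simp add: f_def[abs_def] set_integrable_def)
  have f_nonneg: "0 \<le> f k \<tau>" for k \<tau>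
    using Gamma_real_pos[of \<rho>] \<rho> by (auto simp: f_def g_kernel_def)
  have f_int: "integral\<^sup>L lborel (f k) = Gamma (real k * \<rho> + 1) * J k" for k
    using g_kernel_convolution_power[OF \<rho> t, of k] by (simp add: f_def[abs_def] J_def set_lebesgue_integral_def)
  have wJ: "w k * integral\<^sup>L lborel (f k) = (- \<alpha>) ^ k * J k" for k
    using Gamma_mult_add1_pos[OF \<rho>, of k] by (simp add: f_int w_def)
  \<comment> \<open>\<open>J k\<close> contains \<open>t powr \<rho>\<close> to the power k + 1
    against c to the power k, whence the division by c. With c = |\<alpha>| this justifies the
    interchange of sum and integral.\<close>
  have sumJ: "summable (\<lambda>k. c ^ k * J k)" for c :: real
  proof (cases "c = 0")
    case True
    then show ?thesis by (intro summable_finite[of "{0}"]) auto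
  next
    case False
    have "summable (\<lambda>k. (c * t powr \<rho>) ^ Suc k / Gamma (real (Suc k) * \<rho> + 1))"
      using summable_mittag_leffler[OF \<rho>] by (subst summable_Suc_iff)
    then have "summable (\<lambda>k. (1 / c) * ((c * t powr \<rho>) ^ Suc k / Gamma (real (Suc k) * \<rho> + 1)))"
      by (rule summable_mult)
    then show ?thesis
      using False by (simp add: J_def power_mult_distrib mult_ac)
  qed
  have "(\<lambda>k. \<integral>\<tau>. w k * f k \<tau> \<partial>lborel) sums (\<integral>\<tau>. (\<Sum>k. w k * f k \<tau>) \<partial>lborel)"
  proof (rule sums_integral)
    show "integrable lborel (\<lambda>\<tau>. w k * f k \<tau>)" for k
      using f by simp
    have "summable (\<lambda>k. norm (w k * f k \<tau>))" for \<tau>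
    proof -
      have "summable (\<lambda>k. (\<bar>\<alpha>\<bar> * \<tau> powr \<rho>) ^ k / Gamma (real k * \<rho> + 1) * (indicator {0..t} \<tau> * g_kernel \<rho> (t - \<tau>)))"
        by (intro summable_mult2 summable_mittag_leffler[OF \<rho>])
      moreover have "norm (w k * f k \<tau>) = (\<bar>\<alpha>\<bar> * \<tau> powr \<rho>) ^ k / Gamma (real k * \<rho> + 1) * (indicator {0..t} \<tau> * g_kernel \<rho> (t - \<tau>))" for k
        using Gamma_mult_add1_pos[OF \<rho>, of k] f_nonneg[of k \<tau>]
        by (simp add: abs_mult w_def power_abs) (simp add: f_def power_mult_distrib)
      ultimately show ?thesis by simp
    qed
    then show "AE \<tau> in lborel. summable (\<lambda>k. norm (w k * f k \<tau>))" by simp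
    have "(\<integral>\<tau>. norm (w k * f k \<tau>) \<partial>lborel) = \<bar>\<alpha>\<bar> ^ k * J k" for k
      using f_nonneg Gamma_mult_add1_pos[OF \<rho>, of k] by (simp add: abs_mult f_int w_def power_abs)
    then show "summable (\<lambda>k. \<integral>\<tau>. norm (w k * f k \<tau>) \<partial>lborel)"
      using sumJ by simp
  qed
  moreover have "(\<Sum>k. w k * f k \<tau>) = indicator {0..t} \<tau> *\<^sub>R (g_kernel \<rho> (t - \<tau>) * resolvent_series \<rho> \<alpha> \<tau>)" for \<tau>
  proof (cases "\<tau> \<in> {0..t}")
    case True
    have "(\<Sum>k. w k * f k \<tau>) = (\<Sum>k. g_kernel \<rho> (t - \<tau>) * ((- \<alpha> * \<tau> powr \<rho>) ^ k / Gamma (real k * \<rho> + 1)))"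
      using True unfolding power_mult_distrib by (simp add: w_def f_def mult_ac)
    also have "\<dots> = g_kernel \<rho> (t - \<tau>) * mittag_leffler \<rho> (- \<alpha> * \<tau> powr \<rho>)"
      unfolding mittag_leffler_def by (rule suminf_mult[OF summable_mittag_leffler[OF \<rho>]])
    finally show ?thesis using True by (simp add: resolvent_series_def)
  qed (simp add: f_def)
  ultimately have "(\<lambda>k. (- \<alpha>) ^ k * J k) sums (LBINT \<tau>:{0..t}. g_kernel \<rho> (t - \<tau>) * resolvent_series \<rho> \<alpha> \<tau>)"
    by (simp add: wJ set_lebesgue_integral_def)
  then have "(\<lambda>k. - \<alpha> * ((- \<alpha>) ^ k * J k)) sums (- \<alpha> * (LBINT \<tau>:{0..t}. g_kernel \<rho> (t - \<tau>) * resolvent_series \<rho> \<alpha> \<tau>))"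
    by (rule sums_mult)
  moreover have "- \<alpha> * ((- \<alpha>) ^ k * J k) = (- \<alpha> * t powr \<rho>) ^ Suc k / Gamma (real (Suc k) * \<rho> + 1)" for k
    unfolding J_def power_mult_distrib by simp
  ultimately have "(\<lambda>k. (- \<alpha> * t powr \<rho>) ^ Suc k / Gamma (real (Suc k) * \<rho> + 1)) sums
      (- \<alpha> * (LBINT \<tau>:{0..t}. g_kernel \<rho> (t - \<tau>) * resolvent_series \<rho> \<alpha> \<tau>))"
    by (simp only:)
  then have "(\<lambda>k. (- \<alpha> * t powr \<rho>) ^ k / Gamma (real k * \<rho> + 1)) sums
      (- \<alpha> * (LBINT \<tau>:{0..t}. g_kernel \<rho> (t - \<tau>) * resolvent_series \<rho> \<alpha> \<tau>) + 1)"
    by (subst (asm) sums_Suc_iff) simp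
  then show "resolvent_series \<rho> \<alpha> t + \<alpha> * (LBINT \<tau>:{0..t}. g_kernel \<rho> (t - \<tau>) * resolvent_series \<rho> \<alpha> \<tau>) = 1"
    using t by (simp add: sums_iff resolvent_series_def mittag_leffler_def)
qed

text \<open>The maximum of \<open>|d(t)| exp(-2Kt)\<close> over \<open>[0,a]\<close> is at most half of itself.\<close>

lemma continuous_Gronwall_zero:
  fixes d :: "real \<Rightarrow> real"
  assumes a: "0 \<le> a" and d: "continuous_on {0..a} d" and K: "0 < K"
    and le: "\<And>t. 0 \<le> t \<Longrightarrow> t \<le> a \<Longrightarrow> \<bar>d t\<bar> \<le> K * integral {0..t} (\<lambda>\<tau>. \<bar>d \<tau>\<bar>)"
  shows "d a = 0"
proof -
  define \<phi> where "\<phi> t = \<bar>d t\<bar> * exp (- (2 * K * t))" for t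
  have "continuous_on {0..a} \<phi>"
    unfolding \<phi>_def using d by (intro continuous_intros)
  then obtain s where s: "s \<in> {0..a}" and max: "\<And>t. t \<in> {0..a} \<Longrightarrow> \<phi> t \<le> \<phi> s"
    using continuous_attains_sup[of "{0..a}" \<phi>] a by auto
  have exp: "((\<lambda>\<tau>. \<phi> s * exp (2 * K * \<tau>)) has_integral
      \<phi> s * exp (2 * K * s) / (2 * K) - \<phi> s * exp (2 * K * 0) / (2 * K)) {0..s}"
  proof (rule fundamental_theorem_of_calculus)
    show "((\<lambda>\<tau>. \<phi> s * exp (2 * K * \<tau>) / (2 * K)) has_vector_derivative \<phi> s * exp (2 * K * x)) (at x within {0..s})" for x
      using K unfolding has_real_derivative_iff_has_vector_derivative[symmetric]
      by (auto intro!: derivative_eq_intros)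
  qed (use s in auto)
  have "\<bar>d s\<bar> \<le> K * integral {0..s} (\<lambda>\<tau>. \<bar>d \<tau>\<bar>)"
    using le s by auto
  also have "\<dots> \<le> K * integral {0..s} (\<lambda>\<tau>. \<phi> s * exp (2 * K * \<tau>))"
  proof (intro mult_left_mono integral_le)
    show "(\<lambda>\<tau>. \<bar>d \<tau>\<bar>) integrable_on {0..s}"
      using s by (intro integrable_continuous_interval continuous_intros continuous_on_subset[OF d]) auto
    show "(\<lambda>\<tau>. \<phi> s * exp (2 * K * \<tau>)) integrable_on {0..s}"
      using exp by blast
    fix \<tau> assume "\<tau> \<in> {0..s}"
    then have "\<phi> \<tau> * exp (2 * K * \<tau>) \<le> \<phi> s * exp (2 * K * \<tau>)"
      using s by (intro mult_right_mono max) auto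
    then show "\<bar>d \<tau>\<bar> \<le> \<phi> s * exp (2 * K * \<tau>)"
      by (simp add: \<phi>_def mult.assoc flip: exp_add)
  qed (use K in auto)
  also have "\<dots> = (\<phi> s * exp (2 * K * s) - \<phi> s) / 2"
    using K unfolding integral_unique[OF exp] by (simp add: field_simps)
  also have "\<phi> s * exp (2 * K * s) = \<bar>d s\<bar>"
    by (simp add: \<phi>_def mult.assoc flip: exp_add)
  \<comment> \<open>The chain reads |d s| \<le> (|d s| - \<phi> s) / 2.\<close>
  finally have "\<bar>d s\<bar> \<le> - \<phi> s" by simp
  moreover have "0 \<le> \<phi> s" by (simp add: \<phi>_def)
  ultimately have "\<phi> s = 0" by simp
  then have "\<phi> a \<le> 0" using max[of a] a by auto
  then show ?thesis
    by (simp add: \<phi>_def mult_le_0_iff)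
qed

text \<open>The difference of two solutions solves the homogeneous Volterra equation, whose kernel
  is bounded on [0, a] because its exponent \<rho> - 1 is positive; Gronwall then gives 0.\<close>

lemma scalar_resolvent_unique:
  assumes \<rho>: "1 < \<rho>" and s1: "is_scalar_resolvent \<rho> \<alpha> s1" and s2: "is_scalar_resolvent \<rho> \<alpha> s2"
  shows "s1 = s2"
proof
  fix a :: real
  show "s1 a = s2 a"
  proof (cases "a < 0")
    case True
    then show ?thesis using s1 s2 by (simp add: is_scalar_resolvent_def)
  next
    case False
    then have a: "0 \<le> a" by simp
    define d where "d t = s1 t - s2 t" for t
    have cont: "continuous_on {0..t} s1" "continuous_on {0..t} s2" for t
      using s1 s2 unfolding is_scalar_resolvent_def by (auto elim!: continuous_on_subset)
    then have d: "continuous_on {0..t} d" for t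
      unfolding d_def by (intro continuous_intros)
    \<comment> \<open>|\<alpha>| times the largest value of the kernel on [0, a]; the added 1 keeps
      K positive also when that product is 0.\<close>
    define K where "K = \<bar>\<alpha>\<bar> * (a powr (\<rho> - 1) / Gamma \<rho>) + 1"
    have G: "0 < Gamma \<rho>" using \<rho> by auto
    have "d a = 0"
    proof (rule continuous_Gronwall_zero[OF a d])
      show "0 < K" unfolding K_def using G by (intro add_nonneg_pos) auto
      fix t assume t: "0 \<le> t" "t \<le> a"
      have conv: "(\<lambda>\<tau>. g_kernel \<rho> (t - \<tau>) * s \<tau>) integrable_on {0..t}"
        "(LBINT \<tau>:{0..t}. g_kernel \<rho> (t - \<tau>) * s \<tau>) = integral {0..t} (\<lambda>\<tau>. g_kernel \<rho> (t - \<tau>) * s \<tau>)"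
        if "continuous_on {0..t} s" for s
        using that \<rho> by (auto intro!: set_borel_integral_eq_integral borel_integrable_atLeastAtMost'
            continuous_on_mult continuous_on_g_kernel)
      have "s1 t + \<alpha> * integral {0..t} (\<lambda>\<tau>. g_kernel \<rho> (t - \<tau>) * s1 \<tau>) = 1"
        "s2 t + \<alpha> * integral {0..t} (\<lambda>\<tau>. g_kernel \<rho> (t - \<tau>) * s2 \<tau>) = 1"
        using s1 s2 t conv(2)[OF cont(1)] conv(2)[OF cont(2)] by (auto simp: is_scalar_resolvent_def)
      then have "d t = - \<alpha> * (integral {0..t} (\<lambda>\<tau>. g_kernel \<rho> (t - \<tau>) * s1 \<tau>)
          - integral {0..t} (\<lambda>\<tau>. g_kernel \<rho> (t - \<tau>) * s2 \<tau>))"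
        by (simp add: d_def algebra_simps)
      also have "integral {0..t} (\<lambda>\<tau>. g_kernel \<rho> (t - \<tau>) * s1 \<tau>)
          - integral {0..t} (\<lambda>\<tau>. g_kernel \<rho> (t - \<tau>) * s2 \<tau>) = integral {0..t} (\<lambda>\<tau>. g_kernel \<rho> (t - \<tau>) * d \<tau>)"
        by (subst Henstock_Kurzweil_Integration.integral_diff[symmetric])
          (auto intro: conv(1)[OF cont(1)] conv(1)[OF cont(2)] simp: d_def right_diff_distrib)
      finally have "\<bar>d t\<bar> = \<bar>\<alpha>\<bar> * \<bar>integral {0..t} (\<lambda>\<tau>. g_kernel \<rho> (t - \<tau>) * d \<tau>)\<bar>"
        by (simp add: abs_mult)
      also have "\<bar>integral {0..t} (\<lambda>\<tau>. g_kernel \<rho> (t - \<tau>) * d \<tau>)\<bar>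
          \<le> integral {0..t} (\<lambda>\<tau>. (a powr (\<rho> - 1) / Gamma \<rho>) * \<bar>d \<tau>\<bar>)"
        unfolding real_norm_def[symmetric]
      proof (rule integral_norm_bound_integral)
        show "(\<lambda>\<tau>. g_kernel \<rho> (t - \<tau>) * d \<tau>) integrable_on {0..t}"
          by (rule conv(1)[OF d])
        show "(\<lambda>\<tau>. (a powr (\<rho> - 1) / Gamma \<rho>) * norm (d \<tau>)) integrable_on {0..t}"
          by (intro integrable_continuous_interval continuous_intros d)
        fix \<tau> assume \<tau>: "\<tau> \<in> {0..t}"
        have "(t - \<tau>) powr (\<rho> - 1) \<le> a powr (\<rho> - 1)"
          using \<tau> t \<rho> by (intro powr_mono2) auto
        then show "norm (g_kernel \<rho> (t - \<tau>) * d \<tau>) \<le> (a powr (\<rho> - 1) / Gamma \<rho>) * norm (d \<tau>)"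
          using G by (auto simp: g_kernel_def abs_mult intro!: mult_right_mono divide_right_mono)
      qed
      also have "\<dots> = (a powr (\<rho> - 1) / Gamma \<rho>) * integral {0..t} (\<lambda>\<tau>. \<bar>d \<tau>\<bar>)"
        by simp
      finally have "\<bar>d t\<bar> \<le> \<bar>\<alpha>\<bar> * ((a powr (\<rho> - 1) / Gamma \<rho>) * integral {0..t} (\<lambda>\<tau>. \<bar>d \<tau>\<bar>))"
        by (simp add: mult_left_mono)
      also have "\<dots> \<le> K * integral {0..t} (\<lambda>\<tau>. \<bar>d \<tau>\<bar>)"
        unfolding K_def distrib_right mult.assoc[symmetric]
        by (simp add: Henstock_Kurzweil_Integration.integral_nonneg integrable_continuous_interval d continuous_on_rabs)
      finally show "\<bar>d t\<bar> \<le> K * integral {0..t} (\<lambda>\<tau>. \<bar>d \<tau>\<bar>)" .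
    qed
    then show ?thesis by (simp add: d_def)
  qed
qed

lemma scalar_resolvent_eq_series:
  assumes "1 < \<rho>"
  shows "scalar_resolvent \<rho> \<alpha> = resolvent_series \<rho> \<alpha>"
  unfolding scalar_resolvent_def
  using is_scalar_resolvent_series[OF assms] scalar_resolvent_unique[OF assms] by blast

subsection \<open>Gamma distributed random variables\<close>

lemma gamma_AE_pos:
  assumes X: "distributed N lborel X (gamma_density \<mu> lam)"
  shows "AE \<omega> in N. 0 < X \<omega>"
proof -
  have "AE x in density lborel (\<lambda>x. ennreal (gamma_density \<mu> lam x)). 0 < x"
    using distributed_borel_measurable[OF X]
    by (subst AE_density) (auto simp: gamma_density_def split: if_splits)
  then have "AE x in distr N lborel X. 0 < x"
    unfolding distributed_distr_eq_density[OF X] .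
  then show ?thesis
    using distributed_measurable[OF X] by (subst (asm) AE_distr_iff) auto
qed

text \<open>Weighting with x^m exp(c x) turns the Gamma density with shape \<mu> and rate lam into a
  multiple of the one with shape \<mu> + m and rate lam - c. The case c = 0 gives the moments, the
  case m = 0 the exponential moments behind the strong law.\<close>

lemma gamma_power_exp_moment:
  assumes X: "distributed N lborel X (gamma_density \<mu> lam)"
    and \<mu>: "0 < \<mu>" and lam: "0 < lam" and c: "c < lam"
  shows "has_bochner_integral N (\<lambda>\<omega>. X \<omega> ^ m * exp (c * X \<omega>))
    (lam powr \<mu> * Gamma (\<mu> + m) / (Gamma \<mu> * (lam - c) powr (\<mu> + m)))"
proof (rule has_bochner_integral_nn_integral)
  have [measurable]: "X \<in> borel_measurable N"
    using distributed_measurable[OF X] by simp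
  show "(\<lambda>\<omega>. X \<omega> ^ m * exp (c * X \<omega>)) \<in> borel_measurable N" by measurable
  show "AE \<omega> in N. 0 \<le> X \<omega> ^ m * exp (c * X \<omega>)"
    using gamma_AE_pos[OF X] by eventually_elim simp
  define b s where "b = lam - c" and "s = \<mu> + real m"
  have b: "0 < b" and s: "0 < s" using c \<mu> by (auto simp: b_def s_def)
  have G: "0 < Gamma \<mu>" "0 < Gamma s" using \<mu> s by auto
  define K where "K = lam powr \<mu> / (Gamma \<mu> * b powr s)"
  have K: "0 \<le> K" using G by (simp add: K_def)
  show "0 \<le> lam powr \<mu> * Gamma (\<mu> + real m) / (Gamma \<mu> * (lam - c) powr (\<mu> + real m))"
    using G unfolding s_def by (intro divide_nonneg_nonneg mult_nonneg_nonneg) auto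
  \<comment> \<open>Valid on the whole line: at x = 0 the right-hand side vanishes too, by
    \<open>0 powr _ = 0\<close>. The factor b is kept apart for the substitution y = b x.\<close>
  have pointwise: "gamma_density \<mu> lam x * (x ^ m * exp (c * x))
      = K * b * (indicator {0..} (b * x) * (b * x) powr (s - 1) / exp (b * x))" for x
  proof (cases "0 < x")
    case True
    have e1: "(lam * x) powr (\<mu> - 1) * lam = lam powr \<mu> * x powr (\<mu> - 1)"
      using True lam by (simp add: powr_mult powr_diff)
    have e2: "x powr (\<mu> - 1) * x ^ m = x powr (s - 1)"
      using True by (simp add: s_def powr_realpow[symmetric] flip: powr_add) (simp add: algebra_simps)
    have e3: "exp (- lam * x) * exp (c * x) = 1 / exp (b * x)"
      by (simp add: b_def left_diff_distrib exp_diff exp_minus field_simps)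
    have "gamma_density \<mu> lam x * (x ^ m * exp (c * x))
        = (1 / Gamma \<mu>) * ((lam * x) powr (\<mu> - 1) * lam * x ^ m) * (exp (- lam * x) * exp (c * x))"
      using True by (simp add: gamma_density_def)
    also have "\<dots> = (1 / Gamma \<mu>) * (lam powr \<mu> * x powr (s - 1)) * (1 / exp (b * x))"
      unfolding e1 e3 mult.assoc[of _ _ "x ^ m"] e2 ..
    also have "x powr (s - 1) = (b * x) powr (s - 1) * b / b powr s"
      using True b by (simp add: powr_mult powr_diff)
    also have "(1 / Gamma \<mu>) * (lam powr \<mu> * ((b * x) powr (s - 1) * b / b powr s)) * (1 / exp (b * x))
        = K * b * ((b * x) powr (s - 1) / exp (b * x))"
      by (simp add: K_def)
    finally show ?thesis using True b by (simp add: indicator_def)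
  next
    case False
    then show ?thesis
      using b by (cases "x = 0") (auto simp: gamma_density_def indicator_def zero_le_mult_iff)
  qed
  define \<phi> where "\<phi> y = ennreal (indicator {0..} y * y powr (s - 1) / exp y)" for y :: real
  have [measurable]: "\<phi> \<in> borel_measurable borel"
    unfolding \<phi>_def by measurable
  have "(\<integral>\<^sup>+\<omega>. ennreal (X \<omega> ^ m * exp (c * X \<omega>)) \<partial>N)
      = (\<integral>\<^sup>+x. ennreal (gamma_density \<mu> lam x) * ennreal (x ^ m * exp (c * x)) \<partial>lborel)"
    by (subst distributed_nn_integral[OF X]) auto
  also have "\<dots> = (\<integral>\<^sup>+x. ennreal K * (ennreal b * \<phi> (b * x)) \<partial>lborel)"
  proof (rule nn_integral_cong)
    fix x :: real
    have "0 \<le> gamma_density \<mu> lam x"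
      using G lam by (simp add: gamma_density_def)
    then show "ennreal (gamma_density \<mu> lam x) * ennreal (x ^ m * exp (c * x))
        = ennreal K * (ennreal b * \<phi> (b * x))"
      using K b by (simp add: \<phi>_def pointwise mult.assoc flip: ennreal_mult' ennreal_mult'')
  qed
  also have "\<dots> = ennreal K * (ennreal b * (\<integral>\<^sup>+x. \<phi> (0 + b * x) \<partial>lborel))"
    by (simp add: nn_integral_cmult)
  also have "ennreal b * (\<integral>\<^sup>+x. \<phi> (0 + b * x) \<partial>lborel) = (\<integral>\<^sup>+x. \<phi> x \<partial>lborel)"
    using nn_integral_real_affine[of \<phi> b 0] b by simp
  also have "\<dots> = ennreal (Gamma s)"
    unfolding \<phi>_def by (rule Gamma_conv_nn_integral_real[OF s, symmetric])
  also have "ennreal K * ennreal (Gamma s) = ennreal (lam powr \<mu> * Gamma (\<mu> + m) / (Gamma \<mu> * (lam - c) powr (\<mu> + m)))"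
    using K by (simp add: K_def b_def s_def flip: ennreal_mult')
  finally show "(\<integral>\<^sup>+\<omega>. ennreal (X \<omega> ^ m * exp (c * X \<omega>)) \<partial>N)
      = ennreal (lam powr \<mu> * Gamma (\<mu> + m) / (Gamma \<mu> * (lam - c) powr (\<mu> + m)))" .
qed

lemma gamma_power_moment:
  assumes X: "distributed N lborel X (gamma_density \<mu> lam)"
    and \<mu>: "0 < \<mu>" and lam: "0 < lam"
  shows "has_bochner_integral N (\<lambda>\<omega>. X \<omega> ^ m) (pochhammer \<mu> m / lam ^ m)"
proof -
  have "lam powr \<mu> * Gamma (\<mu> + m) / (Gamma \<mu> * (lam - 0) powr (\<mu> + m)) = pochhammer \<mu> m / lam ^ m"
    using lam by (simp add: pochhammer_Gamma[OF pos_not_nonpos_Int[OF \<mu>]] powr_add powr_realpow)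
  from gamma_power_exp_moment[OF X \<mu> lam lam, of m, unfolded this] show ?thesis
    by simp
qed

text \<open>Identifies the limit of the averaged dominating variables with the sum of the limiting
  coefficients, as Scheffe's lemma requires. X is positive almost surely and c \<ge> 0, so the
  series is its own absolute majorant and may be integrated termwise.\<close>

lemma gamma_mittag_leffler_moment:
  assumes X: "distributed N lborel X (gamma_density \<mu> lam)"
    and \<rho>: "1 < \<rho>" and \<mu>: "0 < \<mu>" and lam: "0 < lam" and c: "0 \<le> c"
  shows "(\<integral>\<omega>. mittag_leffler \<rho> (c * X \<omega>) \<partial>N) = G_function \<rho> \<mu> (c / lam)"
proof -
  have [measurable]: "X \<in> borel_measurable N"
    using distributed_measurable[OF X] by simp
  let ?f = "\<lambda>k \<omega>. (c * X \<omega>) ^ k / Gamma (real k * \<rho> + 1)"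
  have f: "has_bochner_integral N (?f k) (pochhammer \<mu> k / Gamma (real k * \<rho> + 1) * (c / lam) ^ k)" for k
  proof -
    have "has_bochner_integral N (\<lambda>\<omega>. X \<omega> ^ k * (c ^ k / Gamma (real k * \<rho> + 1)))
        (pochhammer \<mu> k / lam ^ k * (c ^ k / Gamma (real k * \<rho> + 1)))"
      by (intro has_bochner_integral_mult_left gamma_power_moment[OF X \<mu> lam])
    then show ?thesis by (simp add: power_mult_distrib power_divide mult_ac)
  qed
  have "(\<lambda>k. integral\<^sup>L N (?f k)) sums (\<integral>\<omega>. (\<Sum>k. ?f k \<omega>) \<partial>N)"
  proof (rule sums_integral)
    show "integrable N (?f k)" for k
      using f by (auto simp: has_bochner_integral_iff)
    have "norm (?f k \<omega>) = \<bar>c * X \<omega>\<bar> ^ k / Gamma (real k * \<rho> + 1)" for k \<omega>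
      using Gamma_mult_add1_pos[OF \<rho>, of k] by (simp add: power_abs)
    then show "AE \<omega> in N. summable (\<lambda>k. norm (?f k \<omega>))"
      using summable_mittag_leffler[OF \<rho>] by simp
    have "(\<integral>\<omega>. norm (?f k \<omega>) \<partial>N) = integral\<^sup>L N (?f k)" for k
    proof (rule integral_cong_AE)
      show "AE \<omega> in N. norm (?f k \<omega>) = ?f k \<omega>"
        using gamma_AE_pos[OF X]
      proof eventually_elim
        case (elim \<omega>)
        then show ?case
          using c Gamma_mult_add1_pos[OF \<rho>, of k] by (simp add: abs_mult power_abs)
      qed
    qed measurable
    then show "summable (\<lambda>k. \<integral>\<omega>. norm (?f k \<omega>) \<partial>N)"
      using summable_G_function[OF \<rho> \<mu>, of "c / lam"]
      by (simp only: has_bochner_integral_integral_eq[OF f])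
  qed
  then show ?thesis
    unfolding has_bochner_integral_integral_eq[OF f]
    by (simp add: sums_iff mittag_leffler_def G_function_def)
qed

text \<open>The 8 comes from the fourth moment: the fourth power of exp(lam x / 8) is exp(lam x /
  2), whose rate stays below lam, so its expectation is finite.\<close>

lemma (in prob_space) gamma_strong_law:
  fixes \<alpha> :: "nat \<Rightarrow> 'a \<Rightarrow> real" and h :: "real \<Rightarrow> real"
  assumes ind: "indep_vars (\<lambda>_. borel) \<alpha> {1..}"
    and \<alpha>: "\<And>k. 1 \<le> k \<Longrightarrow> distributed M lborel (\<alpha> k) (gamma_density \<mu> lam)"
    and \<mu>: "0 < \<mu>" and lam: "0 < lam"
    and h [measurable]: "h \<in> borel_measurable borel"
    and bound: "\<And>x. 0 < x \<Longrightarrow> \<bar>h x\<bar> \<le> C * exp (lam / 8 * x)"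
  shows "AE \<omega> in M. (\<lambda>n. 1 / real n * (\<Sum>k=1..n. h (\<alpha> k \<omega>))) \<longlonglongrightarrow> expectation (\<lambda>\<omega>. h (\<alpha> 1 \<omega>))"
proof -
  have density_nonneg: "0 \<le> gamma_density \<mu> lam x" for x
    using Gamma_real_pos[OF \<mu>] lam by (simp add: gamma_density_def)
  \<comment> \<open>Identical distribution lets the centered moments at k = 1 serve as the bounds v
    and \<kappa> for all k.\<close>
  have eq: "expectation (\<lambda>\<omega>. g (\<alpha> k \<omega>)) = expectation (\<lambda>\<omega>. g (\<alpha> 1 \<omega>))"
    if "1 \<le> k" and "g \<in> borel_measurable borel" for k and g :: "real \<Rightarrow> real"
    using distributed_integral[OF \<alpha>[OF that(1)], of g] distributed_integral[OF \<alpha>[of 1], of g]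
      that(2) density_nonneg by simp
  define m where "m = expectation (\<lambda>\<omega>. h (\<alpha> 1 \<omega>))"
  show ?thesis
    unfolding m_def[symmetric]
  proof (rule strong_law_fourth_moment)
    show "indep_vars (\<lambda>_. borel) (\<lambda>k \<omega>. h (\<alpha> k \<omega>)) {1..}"
      by (rule indep_vars_compose2[OF ind]) simp
    fix k :: nat assume k: "1 \<le> k"
    have [measurable]: "\<alpha> k \<in> borel_measurable M"
      using distributed_measurable[OF \<alpha>[OF k]] by simp
    have "integrable M (\<lambda>\<omega>. C ^ 4 * (\<alpha> k \<omega> ^ 0 * exp (lam / 2 * \<alpha> k \<omega>)))"
      using gamma_power_exp_moment[OF \<alpha>[OF k] \<mu> lam, of "lam / 2" 0] lam
      by (intro integrable_mult_right) (auto simp: has_bochner_integral_iff)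
    then show "integrable M (\<lambda>\<omega>. h (\<alpha> k \<omega>) ^ 4)"
    proof (rule Bochner_Integration.integrable_bound)
      show "AE \<omega> in M. norm (h (\<alpha> k \<omega>) ^ 4) \<le> norm (C ^ 4 * (\<alpha> k \<omega> ^ 0 * exp (lam / 2 * \<alpha> k \<omega>)))"
        using gamma_AE_pos[OF \<alpha>[OF k]]
      proof eventually_elim
        case (elim \<omega>)
        have "\<bar>h (\<alpha> k \<omega>)\<bar> ^ 4 \<le> (C * exp (lam / 8 * \<alpha> k \<omega>)) ^ 4"
          using bound[OF elim] by (intro power_mono) auto
        also have "\<dots> = C ^ 4 * exp (lam / 2 * \<alpha> k \<omega>)"
          by (simp add: power_mult_distrib flip: exp_of_nat_mult)
        finally show ?case by (simp add: power_abs)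
      qed
    qed simp
    show "expectation (\<lambda>\<omega>. h (\<alpha> k \<omega>)) = m"
      using eq[OF k h] by (simp add: m_def)
    show "expectation (\<lambda>\<omega>. (h (\<alpha> k \<omega>) - m)\<^sup>2) \<le> expectation (\<lambda>\<omega>. (h (\<alpha> 1 \<omega>) - m)\<^sup>2)"
      using eq[OF k, of "\<lambda>x. (h x - m)\<^sup>2"] by simp
    show "expectation (\<lambda>\<omega>. (h (\<alpha> k \<omega>) - m) ^ 4) \<le> expectation (\<lambda>\<omega>. (h (\<alpha> 1 \<omega>) - m) ^ 4)"
      using eq[OF k, of "\<lambda>x. (h x - m) ^ 4"] by simp
  qed
qed

subsection \<open>Uniform convergence of the averaged resolvents\<close>

text \<open>Scheffe's lemma: \<open>\<bar>b - a\<bar> = (b - a) + 2 max 0 (a - b)\<close>, and the last term is dominated by \<open>a\<close>.\<close>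

lemma suminf_Scheffe:
  fixes b :: "nat \<Rightarrow> nat \<Rightarrow> real"
  assumes b_nonneg: "\<And>n m. 0 \<le> b n m" and b: "\<And>n. summable (b n)"
    and a_nonneg: "\<And>m. 0 \<le> a m" and a: "summable a"
    and lim: "\<And>m. (\<lambda>n. b n m) \<longlonglongrightarrow> a m" and sum_lim: "(\<lambda>n. suminf (b n)) \<longlonglongrightarrow> suminf a"
  shows "(\<lambda>n. \<Sum>m. \<bar>b n m - a m\<bar>) \<longlonglongrightarrow> 0"
proof -
  define p where "p n m = max 0 (a m - b n m)" for n m
  have p_bound: "0 \<le> p n m" "p n m \<le> a m" for n m
    using b_nonneg[of n m] a_nonneg[of m] by (auto simp: p_def)
  then have p: "summable (p n)" for n
    by (intro summable_comparison_test'[OF a]) auto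
  have "(\<lambda>n. \<Sum>m. p n m) \<longlonglongrightarrow> (\<Sum>m. 0)"
  proof (rule tannerys_theorem[where M = a and a = "\<lambda>m n. p n m" and F = sequentially, THEN conjunct2, THEN conjunct2])
    show "(\<lambda>n. p n m) \<longlonglongrightarrow> 0" for m
      using tendsto_max[OF tendsto_const tendsto_diff[OF tendsto_const lim], of 0 "a m" m]
      by (simp add: p_def)
    show "\<forall>\<^sub>F (m, n) in at_top \<times>\<^sub>F sequentially. norm (p n m) \<le> a m"
      using p_bound by (intro always_eventually) auto
  qed (use a in auto)
  then have "(\<lambda>n. (suminf (b n) - suminf a) + 2 * suminf (p n)) \<longlonglongrightarrow> (suminf a - suminf a) + 2 * 0"
    by (intro tendsto_intros sum_lim) simp
  moreover have "(\<Sum>m. \<bar>b n m - a m\<bar>) = (suminf (b n) - suminf a) + 2 * suminf (p n)" for n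
  proof -
    have "(\<lambda>m. (b n m - a m) + 2 * p n m) sums ((suminf (b n) - suminf a) + 2 * suminf (p n))"
      using a b p by (intro sums_add sums_diff sums_mult summable_sums)
    moreover have "\<bar>b n m - a m\<bar> = (b n m - a m) + 2 * p n m" for m
      by (simp add: p_def max_def)
    ultimately show ?thesis by (simp add: sums_iff)
  qed
  ultimately show ?thesis by simp
qed

text \<open>Exchanging the finite sum with the series exhibits the empirical moments as
  coefficients. At n = 0 everything is 0, since \<open>1 / real 0 = 0\<close>.\<close>

lemma sums_average_mittag_leffler:
  fixes x :: "nat \<Rightarrow> real"
  assumes \<rho>: "1 < \<rho>"
  shows "(\<lambda>m. z ^ m / Gamma (real m * \<rho> + 1) * (1 / real n * (\<Sum>k=1..n. x k ^ m)))
    sums (1 / real n * (\<Sum>k=1..n. mittag_leffler \<rho> (z * x k)))"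
proof -
  have "(\<lambda>m. 1 / real n * (\<Sum>k=1..n. (z * x k) ^ m / Gamma (real m * \<rho> + 1)))
      sums (1 / real n * (\<Sum>k=1..n. mittag_leffler \<rho> (z * x k)))"
    unfolding mittag_leffler_def
    by (intro sums_mult sums_sum summable_sums summable_mittag_leffler[OF \<rho>])
  moreover have "1 / real n * (\<Sum>k=1..n. (z * x k) ^ m / Gamma (real m * \<rho> + 1))
      = z ^ m / Gamma (real m * \<rho> + 1) * (1 / real n * (\<Sum>k=1..n. x k ^ m))" for m
    by (simp add: power_mult_distrib sum_distrib_left sum_divide_distrib mult_ac)
  ultimately show ?thesis by simp
qed

text \<open>With z = -u^\<rho> the two series differ only in their moments. Termwise absolute values
  remove the alternating sign, and |z| \<le> T^\<rho> removes u from the bound.\<close>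

lemma average_resolvent_diff_bound:
  fixes x :: "nat \<Rightarrow> real"
  assumes \<rho>: "1 < \<rho>" and \<mu>: "0 < \<mu>" and u: "0 \<le> u" "u \<le> T"
    and summ: "summable (\<lambda>m. \<bar>(T powr \<rho>) ^ m / Gamma (real m * \<rho> + 1) * (1 / real n * (\<Sum>k=1..n. x k ^ m))
      - (T powr \<rho>) ^ m / Gamma (real m * \<rho> + 1) * (pochhammer \<mu> m / lam ^ m)\<bar>)"
  shows "\<bar>1 / real n * (\<Sum>k=1..n. scalar_resolvent \<rho> (x k) u) - G_function \<rho> \<mu> (- (u powr \<rho> / lam))\<bar>
    \<le> (\<Sum>m. \<bar>(T powr \<rho>) ^ m / Gamma (real m * \<rho> + 1) * (1 / real n * (\<Sum>k=1..n. x k ^ m))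
      - (T powr \<rho>) ^ m / Gamma (real m * \<rho> + 1) * (pochhammer \<mu> m / lam ^ m)\<bar>)"
proof -
  define A where "A m = 1 / real n * (\<Sum>k=1..n. x k ^ m)" for m
  define a where "a m = pochhammer \<mu> m / lam ^ m" for m
  define z where "z = - (u powr \<rho>)"
  define d where "d m = z ^ m / Gamma (real m * \<rho> + 1) * A m - z ^ m / Gamma (real m * \<rho> + 1) * a m" for m
  have "(\<lambda>m. z ^ m / Gamma (real m * \<rho> + 1) * A m)
      sums (1 / real n * (\<Sum>k=1..n. scalar_resolvent \<rho> (x k) u))"
    using sums_average_mittag_leffler[OF \<rho>, of z n x] u
    by (simp add: A_def z_def scalar_resolvent_eq_series[OF \<rho>] resolvent_series_def mult.commute)
  moreover have "(\<lambda>m. z ^ m / Gamma (real m * \<rho> + 1) * a m) sums G_function \<rho> \<mu> (- (u powr \<rho> / lam))"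
  proof -
    have "- (u powr \<rho> / lam) = z / lam" by (simp add: z_def)
    then show ?thesis
      using summable_sums[OF summable_G_function[OF \<rho> \<mu>, of "z / lam"]]
      by (simp add: a_def G_function_def power_divide mult_ac)
  qed
  ultimately have d_sums: "d sums (1 / real n * (\<Sum>k=1..n. scalar_resolvent \<rho> (x k) u) - G_function \<rho> \<mu> (- (u powr \<rho> / lam)))"
    unfolding d_def by (rule sums_diff)
  have d_le: "norm (d m) \<le> \<bar>(T powr \<rho>) ^ m / Gamma (real m * \<rho> + 1) * A m - (T powr \<rho>) ^ m / Gamma (real m * \<rho> + 1) * a m\<bar>" for m
  proof -
    have "(u powr \<rho>) ^ m \<le> (T powr \<rho>) ^ m"
      using u \<rho> by (intro power_mono powr_mono2) auto
    then have "(u powr \<rho>) ^ m / Gamma (real m * \<rho> + 1) * \<bar>A m - a m\<bar>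
        \<le> (T powr \<rho>) ^ m / Gamma (real m * \<rho> + 1) * \<bar>A m - a m\<bar>"
      using Gamma_mult_add1_pos[OF \<rho>, of m] by (intro mult_right_mono divide_right_mono) auto
    moreover have "\<bar>z\<bar> = u powr \<rho>" by (simp add: z_def)
    ultimately show ?thesis
      using Gamma_mult_add1_pos[OF \<rho>, of m]
      unfolding d_def right_diff_distrib[symmetric] by (simp add: abs_mult power_abs)
  qed
  have "norm (suminf d) \<le> (\<Sum>m. norm (d m))"
    using d_le summ by (intro summable_norm summable_comparison_test'[OF summ[folded A_def a_def]]) auto
  also have "\<dots> \<le> (\<Sum>m. \<bar>(T powr \<rho>) ^ m / Gamma (real m * \<rho> + 1) * A m - (T powr \<rho>) ^ m / Gamma (real m * \<rho> + 1) * a m\<bar>)"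
    using summ[folded A_def a_def] d_le
    by (intro suminf_le summable_comparison_test'[OF summ[folded A_def a_def]]) auto
  finally show ?thesis
    using d_sums by (simp add: sums_iff A_def a_def)
qed

text \<open>A single term of the exponential series; it brings the powers of \<alpha> under the
  growth condition of \<open>gamma_strong_law\<close>.\<close>

lemma power_le_fact_mult_exp:
  fixes z :: real
  assumes z: "0 \<le> z"
  shows "z ^ m \<le> fact m * exp z"
proof -
  have "(\<Sum>k\<in>{m}. z ^ k /\<^sub>R fact k) \<le> exp z"
    unfolding exp_def using z by (intro sum_le_suminf summable_exp_generic) auto
  then show ?thesis
    by (simp add: field_simps)
qed

text \<open>The exceptional null set is fixed before n and u: one for positivity of all \<alpha>,
  one for each power, one for the dominating variable. The sequence \<epsilon> may depend on
  \<omega> but not on u.\<close>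

lemma AE_average_resolvent_uniform:
  fixes \<alpha> :: "nat \<Rightarrow> 'b \<Rightarrow> real"
  assumes \<rho>: "1 < \<rho>" and \<mu>: "0 < \<mu>" and lam: "0 < lam"
    and N: "prob_space N" and ind: "prob_space.indep_vars N (\<lambda>_. borel) \<alpha> {1..}"
    and \<alpha>: "\<And>k. 1 \<le> k \<Longrightarrow> distributed N lborel (\<alpha> k) (gamma_density \<mu> lam)"
  shows "AE \<omega> in N. \<exists>\<epsilon>. \<epsilon> \<longlonglongrightarrow> 0 \<and> (\<forall>n. \<forall>u\<in>{0..T}.
    \<bar>1 / real n * (\<Sum>k=1..n. scalar_resolvent \<rho> (\<alpha> k \<omega>) u) - G_function \<rho> \<mu> (- (u powr \<rho> / lam))\<bar> \<le> \<epsilon> n)"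
proof -
  interpret prob_space N by fact
  define c where "c = T powr \<rho>"
  have c: "0 \<le> c" by (simp add: c_def)
  have D1: "distributed N lborel (\<alpha> 1) (gamma_density \<mu> lam)" by (rule \<alpha>) simp
  have pos: "AE \<omega> in N. \<forall>k\<in>{1..}. 0 < \<alpha> k \<omega>"
    using gamma_AE_pos[OF \<alpha>] by (intro AE_ball_countable') auto
  have "AE \<omega> in N. (\<lambda>n. 1 / real n * (\<Sum>k=1..n. \<alpha> k \<omega> ^ m)) \<longlonglongrightarrow> pochhammer \<mu> m / lam ^ m" for m
  proof -
    \<comment> \<open>\<open>power_le_fact_mult_exp\<close> at z = lam x / 8, with the scaling
      undone by (8 / lam)^m.\<close>
    have "\<bar>x ^ m\<bar> \<le> (fact m * (8 / lam) ^ m) * exp (lam / 8 * x)" if x: "0 < x" for x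
    proof -
      have "(lam / 8 * x) ^ m \<le> fact m * exp (lam / 8 * x)"
        using x lam by (intro power_le_fact_mult_exp) simp
      then have "(8 / lam) ^ m * (lam / 8 * x) ^ m \<le> (8 / lam) ^ m * (fact m * exp (lam / 8 * x))"
        using lam by (intro mult_left_mono) auto
      moreover have "(8 / lam) ^ m * (lam / 8 * x) ^ m = x ^ m"
        using lam by (simp flip: power_mult_distrib)
      ultimately have "x ^ m \<le> (fact m * (8 / lam) ^ m) * exp (lam / 8 * x)"
        by (simp only: mult_ac)
      then show ?thesis using x by simp
    qed
    then have "AE \<omega> in N. (\<lambda>n. 1 / real n * (\<Sum>k=1..n. \<alpha> k \<omega> ^ m)) \<longlonglongrightarrow> expectation (\<lambda>\<omega>. \<alpha> 1 \<omega> ^ m)"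
      by (intro gamma_strong_law[OF ind \<alpha> \<mu> lam]) auto
    then show ?thesis
      using gamma_power_moment[OF D1 \<mu> lam, of m] by (simp add: has_bochner_integral_iff)
  qed
  then have moments: "AE \<omega> in N. \<forall>m. (\<lambda>n. 1 / real n * (\<Sum>k=1..n. \<alpha> k \<omega> ^ m)) \<longlonglongrightarrow> pochhammer \<mu> m / lam ^ m"
    by (simp add: AE_all_countable)
  have total: "AE \<omega> in N. (\<lambda>n. 1 / real n * (\<Sum>k=1..n. mittag_leffler \<rho> (c * \<alpha> k \<omega>))) \<longlonglongrightarrow> G_function \<rho> \<mu> (c / lam)"
  proof -
    obtain C where C: "\<And>x. 0 \<le> x \<Longrightarrow> mittag_leffler \<rho> (c * x) \<le> C * exp (lam / 8 * x)"
      using mittag_leffler_exp_bound[OF \<rho>, of "lam / 8" c] lam c by auto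
    have "\<bar>mittag_leffler \<rho> (c * x)\<bar> \<le> C * exp (lam / 8 * x)" if "0 < x" for x
    proof -
      have "0 \<le> mittag_leffler \<rho> (c * x)"
        unfolding mittag_leffler_def using that c Gamma_mult_add1_pos[OF \<rho>]
        by (intro suminf_nonneg summable_mittag_leffler[OF \<rho>] divide_nonneg_nonneg less_imp_le[OF Gamma_mult_add1_pos[OF \<rho>]]) auto
      then show ?thesis using C[of x] that by simp
    qed
    moreover have "continuous_on UNIV (mittag_leffler \<rho>)"
      using isCont_mittag_leffler[OF \<rho>] by (simp add: continuous_on_eq_continuous_at)
    then have "mittag_leffler \<rho> \<in> borel_measurable borel"
      by (rule borel_measurable_continuous_onI)
    then have "(\<lambda>x. mittag_leffler \<rho> (c * x)) \<in> borel_measurable borel" by measurable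
    ultimately show ?thesis
      unfolding gamma_mittag_leffler_moment[OF D1 \<rho> \<mu> lam c, symmetric]
      by (intro gamma_strong_law[OF ind \<alpha> \<mu> lam]) auto
  qed
  show ?thesis
    using pos moments total
  proof eventually_elim
    case (elim \<omega>)
    define w where "w m = c ^ m / Gamma (real m * \<rho> + 1)" for m
    define b where "b n m = w m * (1 / real n * (\<Sum>k=1..n. \<alpha> k \<omega> ^ m))" for n m
    define a where "a m = w m * (pochhammer \<mu> m / lam ^ m)" for m
    have w: "0 \<le> w m" for m
      using c Gamma_mult_add1_pos[OF \<rho>, of m] by (simp add: w_def)
    have b_sums: "b n sums (1 / real n * (\<Sum>k=1..n. mittag_leffler \<rho> (c * \<alpha> k \<omega>)))" for n
      unfolding b_def w_def by (rule sums_average_mittag_leffler[OF \<rho>])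
    have a_sums: "a sums G_function \<rho> \<mu> (c / lam)"
      using summable_sums[OF summable_G_function[OF \<rho> \<mu>, of "c / lam"]]
      by (simp add: a_def[abs_def] w_def G_function_def power_divide mult_ac)
    have b_nonneg: "0 \<le> b n m" for n m
      using w elim(1) by (auto simp: b_def less_imp_le intro!: mult_nonneg_nonneg divide_nonneg_nonneg sum_nonneg)
    have a_nonneg: "0 \<le> a m" for m
      using w pochhammer_pos[OF \<mu>, of m] lam by (simp add: a_def)
    have lim: "(\<lambda>n. \<Sum>m. \<bar>b n m - a m\<bar>) \<longlonglongrightarrow> 0"
    proof (rule suminf_Scheffe[OF b_nonneg _ a_nonneg])
      show "(\<lambda>n. b n m) \<longlonglongrightarrow> a m" for m
        unfolding b_def a_def using elim(2) by (intro tendsto_mult_left) auto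
      show "(\<lambda>n. suminf (b n)) \<longlonglongrightarrow> suminf a"
        using elim(3) a_sums b_sums by (simp add: sums_iff)
    qed (use a_sums b_sums in \<open>auto simp: sums_iff\<close>)
    \<comment> \<open>Not contained in \<open>lim\<close>, since \<open>suminf\<close> has a value
      for divergent series too; the comparison below needs genuine convergence.\<close>
    have summ: "summable (\<lambda>m. \<bar>b n m - a m\<bar>)" for n
    proof (rule summable_comparison_test')
      show "summable (\<lambda>m. b n m + a m)"
        using a_sums b_sums by (intro summable_add) (auto simp: sums_iff)
      show "norm \<bar>b n m - a m\<bar> \<le> b n m + a m" for m
        using a_nonneg[of m] b_nonneg[of n m] by simp
    qed
    have "\<bar>1 / real n * (\<Sum>k=1..n. scalar_resolvent \<rho> (\<alpha> k \<omega>) u) - G_function \<rho> \<mu> (- (u powr \<rho> / lam))\<bar>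
        \<le> (\<Sum>m. \<bar>b n m - a m\<bar>)" if "u \<in> {0..T}" for n u
      using average_resolvent_diff_bound[OF \<rho> \<mu>, of u T n "\<lambda>k. \<alpha> k \<omega>" lam] that summ[of n]
      by (simp only: b_def a_def w_def c_def atLeastAtMost_iff)
    with lim show ?case by blast
  qed
qed

section \<open>Transfer from the kernels to the Wiener integrals\<close>

lemma continuous_on_average_resolvent:
  assumes \<rho>: "1 < \<rho>"
  shows "continuous_on {0..t} (\<lambda>\<tau>. 1 / real n * (\<Sum>k=1..n. scalar_resolvent \<rho> (x k) (t - \<tau>)))"
proof -
  have "continuous_on {0..} (scalar_resolvent \<rho> (x k))" for k
    using is_scalar_resolvent_series[OF \<rho>, of "x k"]
    by (simp add: is_scalar_resolvent_def scalar_resolvent_eq_series[OF \<rho>])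
  then have "continuous_on {0..t} (\<lambda>\<tau>. scalar_resolvent \<rho> (x k) (t - \<tau>))" for k
    by (rule continuous_on_compose2) (auto intro!: continuous_intros)
  then show ?thesis
    by (intro continuous_on_mult continuous_on_const continuous_on_sum)
qed

lemma continuous_on_G_function_kernel:
  assumes \<rho>: "1 < \<rho>" and \<mu>: "0 < \<mu>"
  shows "continuous_on {0..t} (\<lambda>\<tau>. G_function \<rho> \<mu> (- ((t - \<tau>) powr \<rho> / lam)))"
proof -
  have G: "continuous_on UNIV (G_function \<rho> \<mu>)"
    using isCont_G_function[OF \<rho> \<mu>] by (simp add: continuous_on_eq_continuous_at)
  have "continuous_on {0..t} (\<lambda>\<tau>. (t - \<tau>) powr \<rho>)"
    using \<rho> by (intro continuous_on_powr') (auto intro!: continuous_intros)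
  then have "continuous_on {0..t} (\<lambda>\<tau>. - ((t - \<tau>) powr \<rho> / lam))"
    unfolding divide_inverse by (intro continuous_on_minus continuous_on_mult continuous_on_const)
  then show ?thesis
    by (rule continuous_on_compose2[OF G]) simp
qed

lemma has_wiener_integral_square_integrable:
  assumes "has_wiener_integral M W t f X"
  shows "square_integrable (restrict_space lborel {0..t}) f" "square_integrable M X"
  using assms by (auto simp: has_wiener_integral_def L2_tendsto_def)

text \<open>The contraction factor 9 becomes 3 under the root, and replacing the length t by T makes
  the estimate the same for all t.\<close>

lemma wiener_integral_L2_diff_bound:
  fixes f g :: "real \<Rightarrow> real"
  assumes W: "standard_brownian_motion M W" and t: "0 \<le> t" "t \<le> T"
    and f: "continuous_on {0..t} f" and g: "continuous_on {0..t} g"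
    and le: "\<And>\<tau>. \<tau> \<in> {0..t} \<Longrightarrow> \<bar>f \<tau> - g \<tau>\<bar> \<le> b"
  shows "L2_norm M (\<lambda>\<omega>. wiener_integral M W t f \<omega> - wiener_integral M W t g \<omega>) \<le> 3 * sqrt T * b"
proof -
  let ?L = "restrict_space lborel {0..t}"
  note If = has_wiener_integral_wiener_integral[OF W t(1) f]
    and Ig = has_wiener_integral_wiener_integral[OF W t(1) g]
  have b: "0 \<le> b" using order_trans[OF abs_ge_zero le[of 0]] t by simp
  have "AE x in ?L. \<bar>f x - g x\<bar> \<le> b"
    using le by (intro AE_I2) (simp add: space_restrict_space)
  moreover have "(\<lambda>x. f x - g x) \<in> borel_measurable ?L"
    using has_wiener_integral_square_integrable(1)[OF If] has_wiener_integral_square_integrable(1)[OF Ig]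
    by (auto simp: square_integrable_def)
  ultimately have "(\<integral>x. (f x - g x)\<^sup>2 \<partial>?L) \<le> t * b\<^sup>2"
    by (rule bounded_square_integral(2)[OF t(1)])
  also have "\<dots> \<le> T * b\<^sup>2"
    using t by (intro mult_right_mono) auto
  finally have "(\<integral>\<omega>. (wiener_integral M W t f \<omega> - wiener_integral M W t g \<omega>)\<^sup>2 \<partial>M) \<le> 9 * (T * b\<^sup>2)"
    using has_wiener_integral_contraction[OF W If Ig] by linarith
  then have "L2_norm M (\<lambda>\<omega>. wiener_integral M W t f \<omega> - wiener_integral M W t g \<omega>) \<le> sqrt (9 * (T * b\<^sup>2))"
    unfolding L2_norm_def by (rule real_sqrt_le_mono)
  also have "\<dots> = 3 * sqrt T * b"
    using b by (simp add: real_sqrt_mult)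
  finally show ?thesis .
qed

theorem theorem3p3:
  fixes \<rho> \<mu> lam T :: real
    and M :: "'a measure" and W :: "real \<Rightarrow> 'a \<Rightarrow> real"
    and N :: "'b measure" and \<alpha> :: "nat \<Rightarrow> 'b \<Rightarrow> real"
  assumes "1 < \<rho>" and "\<rho> \<le> 2" and "\<mu> > 0" and "lam > 0" and "T > 0"
    and "prob_space N"
    and "prob_space.indep_vars N (\<lambda>_. borel) \<alpha> {1..}"
    and "\<And>k. k \<ge> 1 \<Longrightarrow> distributed N lborel (\<alpha> k) (gamma_density \<mu> lam)"
    and "standard_brownian_motion M W"
  shows "AE \<omega>' in N.
    L2_uniform_limit {0..T} M
      (\<lambda>n t. wiener_integral M W t
         (\<lambda>\<tau>. 1 / real n * (\<Sum>k=1..n. scalar_resolvent \<rho> (\<alpha> k \<omega>') (t - \<tau>))))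
      (\<lambda>t. wiener_integral M W t
         (\<lambda>\<tau>. G_function \<rho> \<mu> (- ((t - \<tau>) powr \<rho> / lam))))"
proof -
  note \<rho> = assms(1) and \<mu> = assms(3) and lam = assms(4) and W = assms(9)
  have "AE \<omega> in N. \<exists>\<epsilon>. \<epsilon> \<longlonglongrightarrow> 0 \<and> (\<forall>n. \<forall>u\<in>{0..T}.
    \<bar>1 / real n * (\<Sum>k=1..n. scalar_resolvent \<rho> (\<alpha> k \<omega>) u) - G_function \<rho> \<mu> (- (u powr \<rho> / lam))\<bar> \<le> \<epsilon> n)"
    by (rule AE_average_resolvent_uniform[OF \<rho> \<mu> lam assms(6-8)])
  then show ?thesis
  proof eventually_elim
    case (elim \<omega>)
    define f where "f n t \<tau> = 1 / real n * (\<Sum>k=1..n. scalar_resolvent \<rho> (\<alpha> k \<omega>) (t - \<tau>))" for n t \<tau>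
    define g where "g t \<tau> = G_function \<rho> \<mu> (- ((t - \<tau>) powr \<rho> / lam))" for t \<tau>
    obtain \<epsilon> where \<epsilon>: "\<epsilon> \<longlonglongrightarrow> 0"
      and le: "\<And>n u. u \<in> {0..T} \<Longrightarrow> \<bar>1 / real n * (\<Sum>k=1..n. scalar_resolvent \<rho> (\<alpha> k \<omega>) u)
        - G_function \<rho> \<mu> (- (u powr \<rho> / lam))\<bar> \<le> \<epsilon> n"
      using elim by blast
    have f: "continuous_on {0..t} (f n t)" for n t
      unfolding f_def by (rule continuous_on_average_resolvent[OF \<rho>])
    have g: "continuous_on {0..t} (g t)" for t
      unfolding g_def by (rule continuous_on_G_function_kernel[OF \<rho> \<mu>])
    have bound: "L2_norm M (\<lambda>\<omega>. wiener_integral M W t (f n t) \<omega> - wiener_integral M W t (g t) \<omega>) \<le> 3 * sqrt T * \<epsilon> n"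
      if "t \<in> {0..T}" for n t
    proof (rule wiener_integral_L2_diff_bound[OF W _ _ f g])
      \<comment> \<open>For 0 \<le> \<tau> \<le> t \<le> T the argument t - \<tau> stays in [0, T],
        so one sequence \<epsilon> serves every t.\<close>
      show "\<bar>f n t \<tau> - g t \<tau>\<bar> \<le> \<epsilon> n" if "\<tau> \<in> {0..t}" for \<tau>
        unfolding f_def g_def using that \<open>t \<in> {0..T}\<close> by (intro le) auto
    qed (use that in auto)
    have nonneg: "0 \<le> L2_norm M X" for X :: "'a \<Rightarrow> real"
      by (simp add: L2_norm_def)
    have "(\<lambda>n. 3 * sqrt T * \<epsilon> n) \<longlonglongrightarrow> 0"
      using \<epsilon> by (rule tendsto_mult_right_zero)
    then have "uniform_limit {0..T} (\<lambda>n t. L2_norm M (\<lambda>\<omega>. wiener_integral M W t (f n t) \<omega> - wiener_integral M W t (g t) \<omega>))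
        (\<lambda>t. 0) sequentially"
      unfolding uniform_limit_iff
    proof (intro allI impI)
      fix e :: real assume "0 < e"
      with \<open>(\<lambda>n. 3 * sqrt T * \<epsilon> n) \<longlonglongrightarrow> 0\<close> have "\<forall>\<^sub>F n in sequentially. 3 * sqrt T * \<epsilon> n < e"
        by (rule order_tendstoD)
      then show "\<forall>\<^sub>F n in sequentially. \<forall>t\<in>{0..T}. dist (L2_norm M (\<lambda>\<omega>. wiener_integral M W t (f n t) \<omega>
          - wiener_integral M W t (g t) \<omega>)) 0 < e"
      proof eventually_elim
        case (elim n)
        then have "L2_norm M (\<lambda>\<omega>. wiener_integral M W t (f n t) \<omega> - wiener_integral M W t (g t) \<omega>) < e"
          if "t \<in> {0..T}" for t
          using bound[OF that, of n] by linarith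
        then show ?case
          using nonneg by simp
      qed
    qed
    moreover have "square_integrable M (wiener_integral M W t (f n t))"
      "square_integrable M (wiener_integral M W t (g t))" if "t \<in> {0..T}" for n t
      using that by (auto intro: has_wiener_integral_square_integrable(2)
          has_wiener_integral_wiener_integral[OF W _ f] has_wiener_integral_wiener_integral[OF W _ g])
    ultimately show ?case
      unfolding L2_uniform_limit_def f_def[abs_def] g_def[abs_def] by auto
  qed
qed

end
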